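(* Let $m\in C(\mathbb{R}^n)$ and set $\widetilde m(\xi):=m(-\xi)$. Assume that the Fourier multiplier operator $\phi\mapsto \widetilde m(D)\phi:=\mathcal{F}^{-1}(\widetilde m\,\widehat\phi)$ maps $C_c^\infty(\mathbb{R}^n)$ into $L^1(\mathbb{R}^n)$. Suppose $f\in L^\infty(\mathbb{R}^n)$ satisfies $m(D)f=0$ as a distribution, i.e. \[ \langle f,\widetilde m(D)\phi\rangle=0\quad\text{for all }\phi\in C_c^\infty(\mathbb{R}^n). \] If $\{\eta\in\mathbb{R}^n\mid m(\eta)=0\}\subseteq\{0\}$, then $f$ is Lebesgue almost everywhere equal to a constant. Conversely, if every $f\in L^\infty(\mathbb{R}^n)$ satisfying $\langle f,\widetilde m(D)\phi\rangle=0$ for all $\phi\in C_c^\infty(\mathbb{R}^n)$ is Lebesgue almost everywhere constant, then $\{\eta\in\mathbb{R}^n\mid m(\eta)=0\}\subseteq\{0\}$.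
   Context: Fourier transform convention: $\mathcal{F}\phi(\xi)=\widehat\phi(\xi)=(2\pi)^{-n}\int_{\mathbb{R}^n}e^{-ix\cdot\xi}\phi(x)\,dx$ and $\mathcal{F}^{-1}u(x)=\int_{\mathbb{R}^n}e^{ix\cdot\xi}u(\xi)\,d\xi$. The pairing is $\langle f,g\rangle=\int_{\mathbb{R}^n}f(x)g(x)\,dx$. *)

theory Defs
  imports "HOL-Analysis.Analysis"
begin

fun iter_deriv :: "'a::euclidean_space list \<Rightarrow> ('a \<Rightarrow> complex) \<Rightarrow> 'a \<Rightarrow> complex" where
  "iter_deriv [] f = f"
| "iter_deriv (v # vs) f = (\<lambda>x. frechet_derivative (iter_deriv vs f) (at x) v)"

definition smooth_fun :: "('a::euclidean_space \<Rightarrow> complex) \<Rightarrow> bool" where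
  "smooth_fun f \<longleftrightarrow> (\<forall>vs. set vs \<subseteq> Basis \<longrightarrow> (\<forall>x. iter_deriv vs f differentiable (at x)))"

definition test_fun :: "('a::euclidean_space \<Rightarrow> complex) \<Rightarrow> bool" where
  "test_fun \<phi> \<longleftrightarrow> smooth_fun \<phi> \<and> compact (closure {x. \<phi> x \<noteq> 0})"

text \<open>Fourier transform with the paper's normalisation (2 pi)^(-n) int e^(-i x.xi) phi(x) dx.\<close>
definition fourier :: "('a::euclidean_space \<Rightarrow> complex) \<Rightarrow> 'a \<Rightarrow> complex" where
  "fourier \<phi> \<xi> = complex_of_real ((2 * pi) powr (- real DIM('a))) *
     (LINT x|lebesgue. cis (- (x \<bullet> \<xi>)) * \<phi> x)"

text \<open>g is (a representative of) the L^1 function mt(D) phi = F^{-1}(mt * F phi), where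
  mt(xi) = m(-xi): g is integrable and its Fourier transform is mt * F phi.\<close>
definition mult_op_L1 :: "('a::euclidean_space \<Rightarrow> complex) \<Rightarrow> ('a \<Rightarrow> complex) \<Rightarrow> ('a \<Rightarrow> complex) \<Rightarrow> bool" where
  "mult_op_L1 m \<phi> g \<longleftrightarrow> integrable lebesgue g \<and> (\<forall>\<xi>. fourier g \<xi> = m (- \<xi>) * fourier \<phi> \<xi>)"

definition Linfty :: "('a::euclidean_space \<Rightarrow> complex) \<Rightarrow> bool" where
  "Linfty f \<longleftrightarrow> f \<in> borel_measurable lebesgue \<and> (\<exists>C. AE x in lebesgue. norm (f x) \<le> C)"

definition solves_mD :: "('a::euclidean_space \<Rightarrow> complex) \<Rightarrow> ('a \<Rightarrow> complex) \<Rightarrow> bool" where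
  "solves_mD m f \<longleftrightarrow> (\<forall>\<phi> g. test_fun \<phi> \<and> mult_op_L1 m \<phi> g \<longrightarrow> (LINT x|lebesgue. f x * g x) = 0)"

end

theory Submission
  imports Defs "HOL-Probability.Levy"
begin

text \<open>If \<open>m \<eta> = 0\<close> with \<open>\<eta> \<noteq> 0\<close>, the character \<open>cis (\<eta> \<bullet> x)\<close> is a non-constant bounded solution.

  Conversely, let \<open>m\<close> vanish at most at \<open>0\<close> and let \<open>f\<close> be a bounded solution. For a narrow bump
  \<open>\<phi>\<close> the function \<open>g\<close> with transform \<open>m (- \<xi>) * fourier \<phi> \<xi>\<close> has no spectral zero in a given annulus
  around \<open>0\<close>, and \<open>f\<close> annihilates all its translates. At each frequency \<open>\<eta>\<close> of the annulus, \<open>g\<close> is close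
  to multiplication by \<open>ft g \<eta>\<close> on functions with spectrum near \<open>\<eta>\<close>, uniformly in \<open>\<eta>\<close>; hence \<open>f\<close>
  annihilates the Fejer kernels modulated by \<open>\<eta>\<close>. Now \<open>h\<close> with mean zero is the limit in the
  integral norm of its band-pass parts \<open>conv h (VP R) - conv h (VP e)\<close> as \<open>R\<close> tends to infinity and \<open>e\<close> to
  zero: the low-frequency part is negligible because the transform of \<open>h\<close> vanishes at \<open>0\<close>. Therefore
  \<open>f\<close> annihilates all such \<open>h\<close>, its averages over all boxes agree, and Lebesgue differentiation
  shows that it is constant.\<close>

section \<open>The Fejer kernel on the line\<close>

text \<open>The obstacle is that \<open>m\<close> is merely continuous, so one cannot multiply the
  distributional transform of \<open>f\<close> by it, let alone divide. Hence \<open>m\<close>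
  enters only through integrable functions \<open>g\<close>, and \<open>ft g\<close> must be
  zero-free only on compact annuli. The transform of one fixed bump may vanish at high frequencies;
  this is why the bump shrinks as the outer radius of the annulus grows. Two families of kernels are
  used, both integrable with compactly supported transforms. Fejer kernels lie between 0 and 1 and
  tend to 1 as they widen, so they serve as cut-offs in space. De la Vallee Poussin kernels have
  transforms equal to one near 0, so convolution with them reproduces narrower spectra exactly. The
  error in replacing \<open>g\<close> by the number \<open>ft g \<eta>\<close> is measured by the
  modulus of continuity in L^1 of a wide kernel. Modulation by \<open>\<eta>\<close> leaves this
  bound unchanged, so one width serves a whole annulus. This uniformity is indispensable, because
  the band-pass argument integrates over all \<open>\<eta>\<close> of the annulus with a single
  Fejer kernel.\<close>

lemma borel_measurable_cis [measurable]: "cis \<in> borel_measurable borel"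
  by (intro borel_measurable_continuous_onI continuous_intros)

definition tent :: "real \<Rightarrow> real" where
  "tent t = max 0 (1 - \<bar>t\<bar>)"

text \<open>Normalised to height one at 0 rather than to integral one (the integral is
  \<open>2 * pi\<close>), since its dilates are to act as cut-offs. The convention
  \<open>sinc 0 = 1\<close> fills in the removable singularity.\<close>

definition fejer :: "real \<Rightarrow> real" where
  "fejer x = (sinc (x / 2))\<^sup>2"

lemma continuous_tent: "continuous_on A tent"
  unfolding tent_def by (intro continuous_intros)

lemma borel_measurable_tent [measurable]: "tent \<in> borel_measurable borel"
  by (rule borel_measurable_continuous_onI[OF continuous_tent])

lemma isCont_fejer: "isCont fejer x"
  unfolding fejer_def
  by (intro continuous_intros isCont_o2[OF _ isCont_sinc]) auto

lemma borel_measurable_fejer [measurable]: "fejer \<in> borel_measurable borel"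
  by (intro borel_measurable_continuous_onI continuous_at_imp_continuous_on ballI isCont_fejer)

lemma fejer_0 [simp]: "fejer 0 = 1"
  by (simp add: fejer_def)

lemma fejer_eq: "x \<noteq> 0 \<Longrightarrow> fejer x = (2 - 2 * cos x) / x\<^sup>2"
  using cos_double_sin[of "x/2"] by (simp add: fejer_def power_divide)

lemma fejer_nonneg: "0 \<le> fejer x"
  by (simp add: fejer_def)

lemma fejer_le_1: "fejer x \<le> 1"
proof -
  have "\<bar>sinc (x/2)\<bar> \<le> 1"
    using abs_sin_x_le_abs_x[of "x/2"] by (auto simp: divide_simps)
  then show ?thesis
    unfolding fejer_def by (rule abs_square_le_1[THEN iffD2])
qed

lemma tent_bounds: "0 \<le> tent t" "tent t \<le> 1" "1 \<le> \<bar>t\<bar> \<Longrightarrow> tent t = 0"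
  by (auto simp: tent_def)

lemma integrable_tent: "integrable lborel tent"
proof -
  have "integrable lborel (\<lambda>t. indicator {-1..1} t *\<^sub>R tent t)"
    using borel_integrable_compact[of "{-1..1::real}" tent] continuous_tent by auto
  also have "(\<lambda>t. indicator {-1..1} t *\<^sub>R tent t) = tent"
    by (auto simp: tent_def indicator_def fun_eq_iff max_def)
  finally show ?thesis .
qed

lemma integrable_fejer: "integrable lborel fejer"
proof -
  \<comment> \<open>The constant is 1 + 4: \<open>fejer x\<close> is at most 1, and
    \<open>x\<^sup>2 * fejer x\<close> equals \<open>4 * (sin (x/2))\<^sup>2\<close>.\<close>
  have *: "fejer x \<le> 5 * inverse (1 + x\<^sup>2)" for x
  proof -
    have "fejer x * (1 + x\<^sup>2) = fejer x + 4 * (sin (x/2))\<^sup>2"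
      by (simp add: fejer_def field_simps)
    also have "\<dots> \<le> 1 + 4 * 1"
      by (intro add_mono mult_left_mono fejer_le_1) (auto simp: power_le_one_iff abs_square_le_1)
    finally show ?thesis
      by (simp add: field_simps add_pos_nonneg)
  qed
  have I: "set_integrable lborel {0<..} (\<lambda>x. inverse (1 + x\<^sup>2) :: real)"
    using integrable_I0i_1_div_plus_square
    by (simp add: interval_lebesgue_integrable_def greaterThan_def zero_ereal_def divide_inverse)
  have P: "integrable lborel (\<lambda>x. indicator {0<..} x * fejer x)"
  proof (rule Bochner_Integration.integrable_bound)
    show "integrable lborel (\<lambda>x. 5 * (indicator {0<..} x *\<^sub>R (inverse (1 + x\<^sup>2) :: real)))"
      using I by (intro integrable_mult_right) (simp add: set_integrable_def)
    show "AE x in lborel. norm (indicator {0<..} x * fejer x) \<le>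
       norm (5 * (indicator {0<..} x *\<^sub>R (inverse (1 + x\<^sup>2) :: real)))"
      using * fejer_nonneg by (auto simp: indicator_def abs_mult)
  qed auto
  \<comment> \<open>The comparison function is known to be integrable on a half line;
    \<open>fejer\<close> is even, so the reflected copy covers the other half and only the point 0
    is left out.\<close>
  have N: "integrable lborel (\<lambda>x. indicator {0<..} (-x) * fejer (-x))"
    using lborel_integrable_real_affine[OF P, of "-1" 0] by simp
  have "integrable lborel (\<lambda>x. indicator {0<..} x * fejer x + indicator {0<..} (-x) * fejer (-x))"
    using P N by (rule Bochner_Integration.integrable_add)
  moreover have "AE x in lborel. indicator {0<..} x * fejer x + indicator {0<..} (-x) * fejer (-x) = fejer x"
    using AE_lborel_singleton[of 0] by eventually_elim (auto simp: indicator_def fejer_def)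
  ultimately show ?thesis
    by (subst (asm) integrable_cong_AE[where g=fejer]) auto
qed

text \<open>The tent has a kink at 0, so the integral is split there and each half has an explicit
  primitive. The primitives are functions of a complex variable, restricted to the real axis, and
  they divide by \<open>x\<close>; hence the separate case \<open>x = 0\<close>.\<close>

lemma integral_tent_cis:
  "(LINT t|lborel. cis (x * t) * complex_of_real (tent t)) = complex_of_real (fejer x)"
proof -
  let ?f = "\<lambda>t. cis (x * t) * complex_of_real (tent t)"
  have cont: "continuous_on A ?f" for A
    by (intro continuous_intros continuous_tent)
  have int: "integrable lborel (\<lambda>t. indicator {a..b} t *\<^sub>R ?f t)" for a b
    using borel_integrable_compact[of "{a..b}" ?f] cont by auto
  have split: "(LINT t|lborel. ?f t) =
    (LINT t|lborel. indicator {-1..0} t *\<^sub>R ?f t) + (LINT t|lborel. indicator {0..1} t *\<^sub>R ?f t)"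
  proof (subst Bochner_Integration.integral_add[symmetric, OF int int], intro integral_cong_AE)
    show "AE t in lborel. ?f t = indicator {-1..0} t *\<^sub>R ?f t + indicator {0..1} t *\<^sub>R ?f t"
      using AE_lborel_singleton[of 0] by eventually_elim (auto simp: indicator_def tent_def)
  qed measurable
  let ?c = "\<i> * complex_of_real x"
  have E: "cis (x * t) = exp (?c * of_real t)" for t
    by (simp add: cis_conv_exp mult_ac)
  have FTC: "(LINT t|lborel. indicator {a..b} t *\<^sub>R ?f t) = G (of_real b) - G (of_real a)"
    if "a \<le> b" "\<And>t. a \<le> t \<Longrightarrow> t \<le> b \<Longrightarrow> (G has_field_derivative ?f t) (at (complex_of_real t))" for a b G
    by (rule integral_FTC_atLeastAtMost[where F="\<lambda>t. G (of_real t)"])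
       (use that cont in \<open>auto intro!: has_vector_derivative_real_field\<close>)
  show ?thesis
  proof (cases "x = 0")
    case True
    have a: "(LINT t|lborel. indicator {-1..0} t *\<^sub>R ?f t) =
        (\<lambda>z. z + z\<^sup>2/2) (of_real 0) - (\<lambda>z. z + z\<^sup>2/2) (of_real (-1))"
      by (rule FTC) (use True in \<open>auto intro!: derivative_eq_intros simp: tent_def\<close>)
    have b: "(LINT t|lborel. indicator {0..1} t *\<^sub>R ?f t) =
        (\<lambda>z. z - z\<^sup>2/2) (of_real 1) - (\<lambda>z. z - z\<^sup>2/2) (of_real 0)"
      by (rule FTC) (use True in \<open>auto intro!: derivative_eq_intros simp: tent_def\<close>)
    show ?thesis unfolding split a b using True by simp
  next
    case False
    have a: "(LINT t|lborel. indicator {-1..0} t *\<^sub>R ?f t) =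
      (\<lambda>z. exp (?c * z) * (1 + z) / ?c - exp (?c * z) / ?c\<^sup>2) (of_real 0) -
      (\<lambda>z. exp (?c * z) * (1 + z) / ?c - exp (?c * z) / ?c\<^sup>2) (of_real (-1))"
    proof (rule FTC)
      fix t :: real assume t: "-1 \<le> t" "t \<le> 0"
      show "((\<lambda>z. exp (?c * z) * (1 + z) / ?c - exp (?c * z) / ?c\<^sup>2) has_field_derivative ?f t)
        (at (of_real t))"
        unfolding E using False t
        by (auto intro!: derivative_eq_intros simp: tent_def power2_eq_square) (simp add: field_simps)
    qed auto
    have b: "(LINT t|lborel. indicator {0..1} t *\<^sub>R ?f t) =
      (\<lambda>z. exp (?c * z) * (1 - z) / ?c + exp (?c * z) / ?c\<^sup>2) (of_real 1) -
      (\<lambda>z. exp (?c * z) * (1 - z) / ?c + exp (?c * z) / ?c\<^sup>2) (of_real 0)"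
    proof (rule FTC)
      fix t :: real assume t: "0 \<le> t" "t \<le> 1"
      show "((\<lambda>z. exp (?c * z) * (1 - z) / ?c + exp (?c * z) / ?c\<^sup>2) has_field_derivative ?f t)
        (at (of_real t))"
        unfolding E using False t
        by (auto intro!: derivative_eq_intros simp: tent_def power2_eq_square) (simp add: field_simps)
    qed auto
    have F: "complex_of_real (fejer x) = (2 - exp ?c - exp (- ?c)) / (complex_of_real x)\<^sup>2"
    proof -
      have "2 - exp ?c - exp (- ?c) = complex_of_real (2 - 2 * cos x)"
        using E[of 1] E[of "-1"] by (simp add: complex_eq_iff flip: E)
      then show ?thesis using False by (simp add: fejer_eq)
    qed
    show ?thesis
      unfolding split a b F using False by (simp add: field_simps power2_eq_square)
  qed
qed

text \<open>Levy inversion of the uniform distribution on an interval of length one, evaluated on the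
  unit interval centred at \<open>t\<close>: the inversion integrand is the modulated Fejer kernel and the
  measure of the interval is \<open>tent t\<close>.\<close>

lemma integral_fejer_cis:
  "(LINT x|lborel. cis (- (x * t)) * complex_of_real (fejer x)) = complex_of_real (2 * pi * tent t)"
proof -
  define M :: "real measure" where "M = density lborel (\<lambda>x. ennreal (indicator {-1/2..1/2} x))"
  have em: "emeasure M A = emeasure lborel ({-1/2..1/2} \<inter> A)" if "A \<in> sets borel" for A
    using that unfolding M_def ennreal_indicator by (intro emeasure_restricted) auto
  have "prob_space M"
    by (rule prob_spaceI) (use em[of UNIV] in \<open>simp add: M_def\<close>)
  then interpret M: real_distribution M
    by (rule real_distribution.intro) (simp add: real_distribution_axioms_def M_def)
  have cis_diff: "cis (s / 2) - cis (- (s / 2)) = 2 * \<i> * complex_of_real (sin (s / 2))" for s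
    by (simp add: complex_eq_iff)
  have char: "char M s = complex_of_real (sinc (s / 2))" for s
  proof -
    have "char M s = (LINT x|lborel. indicator {-1/2..1/2} x *\<^sub>R iexp (s * x))"
      unfolding char_def M_def
      by (subst integral_density) auto
    also have "\<dots> = complex_of_real (sinc (s / 2))"
    proof (cases "s = 0")
      case True
      then show ?thesis by (simp add: of_real_def[symmetric])
    next
      case False
      have "(LINT x|lborel. indicator {-1/2..1/2} x *\<^sub>R iexp (s * x)) =
        (\<lambda>x. iexp (s * x) / (\<i> * s)) (1/2) - (\<lambda>x. iexp (s * x) / (\<i> * s)) (-1/2)"
      proof (rule integral_FTC_atLeastAtMost)
        show "((\<lambda>x. iexp (s * x) / (\<i> * s)) has_vector_derivative iexp (s * x)) (at x within {-1/2..1/2})" for x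
        proof -
          have "((\<lambda>z. exp (\<i> * (s * z)) / (\<i> * s)) has_field_derivative iexp (s * x)) (at (complex_of_real x))"
            using False by (auto intro!: derivative_eq_intros) (simp add: mult_ac)
          from has_vector_derivative_real_field[OF this] show ?thesis by simp
        qed
      qed (auto intro!: continuous_intros)
      also have "\<dots> = (cis (s / 2) - cis (- (s / 2))) / (\<i> * s)"
        by (simp add: cis_conv_exp diff_divide_distrib)
      finally show ?thesis
        unfolding cis_diff using False by simp
    qed
    finally show ?thesis .
  qed
  let ?a = "t - 1/2" and ?b = "t + 1/2"
  let ?g = "\<lambda>x. cis (- (x * t)) * complex_of_real (fejer x)"
  have g: "complex_integrable lborel ?g"
    by (rule Bochner_Integration.integrable_bound[OF integrable_fejer])
       (auto simp: norm_mult)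
  have null: "measure M {c} = 0" for c
    unfolding measure_def by (subst em) (auto simp: Int_insert_right)
  have meas: "measure M {?a<..?b} = tent t"
  proof -
    consider "t < -1" | "t \<ge> 1" | "-1 \<le> t" "t < 0" | "0 \<le> t" "t < 1" by linarith
    then have "emeasure lborel ({-1/2..1/2} \<inter> {?a<..?b}) = ennreal (tent t)"
    proof cases
      case 1
      then have "{-1/2..1/2} \<inter> {?a<..?b} = {}" by auto
      then show ?thesis using 1 by (simp add: tent_def)
    next
      case 2
      then have "{-1/2..1/2} \<inter> {?a<..?b} = {}" by auto
      then show ?thesis using 2 by (simp add: tent_def)
    next
      case 3
      then have "{-1/2..1/2} \<inter> {?a<..?b} = {-1/2..?b}" by auto
      then show ?thesis using 3 by (simp add: tent_def)
    next
      case 4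
      then have "{-1/2..1/2} \<inter> {?a<..?b} = {?a<..1/2}" by auto
      then show ?thesis using 4 by (simp add: tent_def)
    qed
    then show ?thesis
      unfolding measure_def by (subst em) (simp_all add: tent_bounds)
  qed
  \<comment> \<open>One factor \<open>sinc (s / 2)\<close> is the characteristic function of the
    uniform law, the other comes from the unit length of the interval; together they give
    \<open>fejer s\<close>. The excluded point 0 is a null set.\<close>
  have eq: "(iexp (- (s * ?a)) - iexp (- (s * ?b))) / (\<i> * s) * char M s = ?g s" if "s \<noteq> 0" for s
  proof -
    have "iexp (- (s * ?a)) - iexp (- (s * ?b)) = cis (- (s * t)) * (cis (s / 2) - cis (- (s / 2)))"
      unfolding cis_conv_exp[symmetric] by (simp add: right_diff_distrib cis_mult) (simp add: algebra_simps)
    also note cis_diff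
    finally show ?thesis
      using that by (simp add: char fejer_def power2_eq_square)
  qed
  have "(CLBINT s=-real T..real T. (iexp (- (s * ?a)) - iexp (- (s * ?b))) / (\<i> * s) * char M s)
    = (LINT s|lborel. indicator {-real T<..<real T} s *\<^sub>R ?g s)" for T
  proof -
    let ?h = "\<lambda>s. (iexp (- (s * ?a)) - iexp (- (s * ?b))) / (\<i> * s) * char M s"
    have "(CLBINT s=-real T..real T. ?h s) = (LINT s|lborel. indicator {-real T<..<real T} s *\<^sub>R ?h s)"
    proof -
      have "ereal (- real T) \<le> ereal (real T)" "einterval (ereal (- real T)) (ereal (real T)) = {-real T<..<real T}"
        by (auto simp: einterval_iff)
      then show ?thesis
        by (simp only: interval_lebesgue_integral_def set_lebesgue_integral_def if_True)
    qed
    also have "\<dots> = (LINT s|lborel. indicator {-real T<..<real T} s *\<^sub>R ?g s)"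
    proof (rule integral_cong_AE)
      show "AE s in lborel. indicator {-real T<..<real T} s *\<^sub>R ?h s = indicator {-real T<..<real T} s *\<^sub>R ?g s"
        using AE_lborel_singleton[of 0] by eventually_elim (simp only: eq not_False_eq_True)
    qed (unfold char, measurable)
    finally show ?thesis .
  qed
  then have "(\<lambda>T. 1 / (2 * pi) * (LINT s|lborel. indicator {-real T<..<real T} s *\<^sub>R ?g s)) \<longlonglongrightarrow> tent t"
    using M.Levy_Inversion[OF _ null null, of ?a ?b] meas by simp
  \<comment> \<open>Levy inversion gives a limit of truncated integrals. As \<open>fejer\<close> is
    integrable, that limit is also the full integral.\<close>
  moreover have "(\<lambda>T. 1 / (2 * pi) * (LINT s|lborel. indicator {-real T<..<real T} s *\<^sub>R ?g s))
    \<longlonglongrightarrow> 1 / (2 * pi) * (LINT s|lborel. ?g s)"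
  proof (intro tendsto_mult tendsto_const integral_dominated_convergence[where w="\<lambda>s. norm (?g s)"])
    have ev: "\<forall>\<^sub>F T in sequentially. indicator {-real T<..<real T} s *\<^sub>R ?g s = ?g s" for s
    proof -
      obtain N where "\<bar>s\<bar> < real N" using reals_Archimedean2 by blast
      then show ?thesis
        by (intro eventually_sequentiallyI[of N]) (auto simp: indicator_def abs_less_iff)
    qed
    show "AE s in lborel. (\<lambda>T. indicator {-real T<..<real T} s *\<^sub>R ?g s) \<longlonglongrightarrow> ?g s"
      by (intro AE_I2 tendsto_eventually ev)
  next
    show "AE s in lborel. norm (indicator {-real T<..<real T} s *\<^sub>R ?g s) \<le> norm (?g s)" for T
      by (intro always_eventually allI) (simp add: indicator_def)
  next
    show "integrable lborel (\<lambda>s. norm (?g s))"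
      by (rule integrable_norm[OF g])
  qed measurable
  ultimately have "complex_of_real (tent t) = 1 / (2 * pi) * (LINT s|lborel. ?g s)"
    by (rule LIMSEQ_unique)
  then show ?thesis by (simp add: field_simps)
qed

section \<open>Integrals of products over the coordinates\<close>

lemma
  fixes f :: "'a::euclidean_space \<Rightarrow> real \<Rightarrow> 'b::{real_normed_field,banach,second_countable_topology}"
  assumes f: "\<And>b. b \<in> Basis \<Longrightarrow> integrable lborel (f b)"
  shows integrable_lborel_prod: "integrable lborel (\<lambda>x. \<Prod>b\<in>Basis. f b (x \<bullet> b))"
    and integral_lborel_prod:
      "(LINT x|lborel. (\<Prod>b\<in>Basis. f b (x \<bullet> b))) = (\<Prod>b\<in>Basis. (LINT t|lborel. f b t))"
proof -
  interpret product_sigma_finite "\<lambda>_::'a. lborel :: real measure" ..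
  have [measurable]: "b \<in> Basis \<Longrightarrow> f b \<in> borel_measurable borel" for b
    using f by auto
  have *: "(\<Prod>b\<in>Basis. f b ((\<Sum>c\<in>Basis. x c *\<^sub>R c) \<bullet> b)) = (\<Prod>b\<in>Basis. f b (x b))" for x :: "'a \<Rightarrow> real"
    by (intro prod.cong refl) simp
  show "integrable lborel (\<lambda>x. \<Prod>b\<in>Basis. f b (x \<bullet> b))"
    by (subst lborel_eq, subst integrable_distr_eq) (auto simp: * intro!: product_integrable_prod f)
  show "(LINT x|lborel. (\<Prod>b\<in>Basis. f b (x \<bullet> b))) = (\<Prod>b\<in>Basis. (LINT t|lborel. f b t))"
    by (subst lborel_eq, subst integral_distr) (auto simp: * intro!: product_integral_prod f)
qed

section \<open>Fourier pairs of product kernels\<close>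

text \<open>The sign in the exponent is positive and there is no constant, so \<open>p\<close> is
  thought of as living on either side of the transform. Both functions are real because the kernels
  concerned are even.\<close>

definition fourier_pair :: "('a::euclidean_space \<Rightarrow> real) \<Rightarrow> ('a \<Rightarrow> real) \<Rightarrow> bool" where
  "fourier_pair p q \<longleftrightarrow> integrable lborel p \<and>
     (\<forall>y. (LINT x|lborel. cis (y \<bullet> x) * complex_of_real (p x)) = complex_of_real (q y))"

lemma complex_integrable_cis_mult:
  fixes p :: "'a::euclidean_space \<Rightarrow> complex"
  assumes "integrable lborel p"
  shows "integrable lborel (\<lambda>x. cis (y \<bullet> x) * p x)"
  by (rule Bochner_Integration.integrable_bound[OF assms]) (use assms in \<open>auto simp: norm_mult\<close>)

lemma fourier_pair_tent: "fourier_pair tent fejer"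
  using integral_tent_cis by (simp add: fourier_pair_def integrable_tent)

lemma fourier_pair_fejer: "fourier_pair fejer (\<lambda>y. 2 * pi * tent y)"
proof -
  have "(LINT x|lborel. cis (y * x) * complex_of_real (fejer x)) = complex_of_real (2 * pi * tent y)" for y
    using integral_fejer_cis[of "- y"] by (simp add: tent_def mult.commute)
  then show ?thesis by (simp add: fourier_pair_def integrable_fejer)
qed

lemma fourier_pair_lincomb:
  fixes p p' :: "'a::euclidean_space \<Rightarrow> real"
  assumes "fourier_pair p q" "fourier_pair p' q'"
  shows "fourier_pair (\<lambda>x. a * p x - b * p' x) (\<lambda>y. a * q y - b * q' y)"
  unfolding fourier_pair_def
proof (intro conjI allI)
  have [simp]: "integrable lborel p" "integrable lborel p'"
    using assms by (auto simp: fourier_pair_def)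
  show "integrable lborel (\<lambda>x. a * p x - b * p' x)" by simp
  fix y :: 'a
  let ?i = "\<lambda>p x::'a. cis (y \<bullet> x) * complex_of_real (p x)"
  have "integrable lborel (?i p)" "integrable lborel (?i p')"
    by (intro complex_integrable_cis_mult; simp)+
  then have "(LINT x|lborel. complex_of_real a * ?i p x - complex_of_real b * ?i p' x) =
      a * complex_of_real (q y) - b * complex_of_real (q' y)"
    using assms by (simp add: fourier_pair_def)
  then show "(LINT x|lborel. cis (y \<bullet> x) * complex_of_real (a * p x - b * p' x))
      = complex_of_real (a * q y - b * q' y)"
    by (simp add: algebra_simps)
qed

lemma fourier_pair_scale:
  fixes p q :: "real \<Rightarrow> real"
  assumes "fourier_pair p q" "c > 0"
  shows "fourier_pair (\<lambda>x. c * p (c * x)) (\<lambda>y. q (y / c))"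
  unfolding fourier_pair_def
proof (intro conjI allI)
  have p: "integrable lborel p" using assms by (auto simp: fourier_pair_def)
  show "integrable lborel (\<lambda>x. c * p (c * x))"
    using lborel_integrable_real_affine[OF p, of c 0] assms by simp
  fix y
  have "complex_of_real (q (y / c)) = (LINT x|lborel. cis ((y / c) * x) * complex_of_real (p x))"
    using assms by (simp add: fourier_pair_def flip: times_divide_eq_left)
  also have "\<dots> = c *\<^sub>R (LINT x|lborel. cis ((y / c) * (c * x)) * complex_of_real (p (c * x)))"
    using lborel_integral_real_affine[of c "\<lambda>x. cis ((y / c) * x) * complex_of_real (p x)" 0] assms by simp
  also have "\<dots> = (LINT x|lborel. cis (y \<bullet> x) * complex_of_real (c * p (c * x)))"
    unfolding scaleR_conv_of_real integral_mult_right_zero[symmetric]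
    by (intro Bochner_Integration.integral_cong refl) (use assms in \<open>simp add: mult_ac\<close>)
  finally show "(LINT x|lborel. cis (y \<bullet> x) * complex_of_real (c * p (c * x))) = complex_of_real (q (y / c))"
    by simp
qed

lemma cis_sum: "cis (\<Sum>i\<in>I. f i) = (\<Prod>i\<in>I. cis (f i))"
  by (induction I rule: infinite_finite_induct) (simp_all flip: cis_mult)

lemma fourier_pair_prod:
  fixes p q :: "real \<Rightarrow> real"
  assumes "fourier_pair p q"
  shows "fourier_pair (\<lambda>x::'a::euclidean_space. \<Prod>b\<in>Basis. p (x \<bullet> b)) (\<lambda>y. \<Prod>b\<in>Basis. q (y \<bullet> b))"
  unfolding fourier_pair_def
proof (intro conjI allI)
  have p: "integrable lborel p" using assms by (auto simp: fourier_pair_def)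
  then show "integrable lborel (\<lambda>x::'a. \<Prod>b\<in>Basis. p (x \<bullet> b))"
    by (rule integrable_lborel_prod)
  fix y :: 'a
  have "cis (y \<bullet> x) * complex_of_real (\<Prod>b\<in>Basis. p (x \<bullet> b))
      = (\<Prod>b\<in>Basis. cis ((y \<bullet> b) * (x \<bullet> b)) * complex_of_real (p (x \<bullet> b)))" for x
    by (subst euclidean_inner) (simp add: cis_sum prod.distrib)
  then have "(LINT x|lborel. cis (y \<bullet> x) * complex_of_real (\<Prod>b\<in>Basis. p (x \<bullet> b)))
      = (\<Prod>b\<in>Basis. (LINT t|lborel. cis ((y \<bullet> b) * t) * complex_of_real (p t)))"
    using integral_lborel_prod[of "\<lambda>b t. cis ((y \<bullet> b) * t) * complex_of_real (p t)"]
      complex_integrable_cis_mult[of "\<lambda>t. complex_of_real (p t)"] p by simp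
  then show "(LINT x|lborel. cis (y \<bullet> x) * complex_of_real (\<Prod>b\<in>Basis. p (x \<bullet> b)))
      = complex_of_real (\<Prod>b\<in>Basis. q (y \<bullet> b))"
    using assms by (simp add: fourier_pair_def)
qed

section \<open>De la Vallee Poussin kernels and the kernels in several dimensions\<close>

definition trapezoid :: "real \<Rightarrow> real" where
  "trapezoid t = 2 * tent (t / 2) - tent t"

text \<open>The de la Vallee Poussin kernel, a combination of two Fejer kernels whose transform
  \<open>trapezoid\<close> is a combination of two tents: unlike a single tent it is flat on
  [-1, 1], and it still vanishes outside [-2, 2].\<close>

definition vallee_poussin :: "real \<Rightarrow> real" where
  "vallee_poussin x = (4 * fejer (2 * x) - fejer x) / (2 * pi)"

lemma trapezoid_eq_1: "\<bar>t\<bar> \<le> 1 \<Longrightarrow> trapezoid t = 1"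
  by (auto simp: trapezoid_def tent_def)

lemma trapezoid_eq_0: "2 \<le> \<bar>t\<bar> \<Longrightarrow> trapezoid t = 0"
  by (auto simp: trapezoid_def tent_def)

lemma fourier_pair_vallee_poussin: "fourier_pair vallee_poussin trapezoid"
proof -
  have "fourier_pair (\<lambda>x. 1 / pi * (2 * fejer (2 * x)) - 1 / (2 * pi) * fejer x)
     (\<lambda>y. 1 / pi * (2 * pi * tent (y / 2)) - 1 / (2 * pi) * (2 * pi * tent y))"
    by (intro fourier_pair_lincomb fourier_pair_scale fourier_pair_fejer) simp
  then show ?thesis
    by (simp add: vallee_poussin_def[abs_def] trapezoid_def[abs_def] diff_divide_distrib)
qed

lemma fourier_pair_trapezoid: "fourier_pair trapezoid (\<lambda>y. 2 * pi * vallee_poussin y)"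
proof -
  have "fourier_pair (\<lambda>x. 4 * (1/2 * tent (1/2 * x)) - 1 * tent x)
     (\<lambda>y. 4 * fejer (y / (1/2)) - 1 * fejer y)"
    by (intro fourier_pair_lincomb fourier_pair_scale fourier_pair_tent) simp
  then show ?thesis
    by (simp add: vallee_poussin_def[abs_def] trapezoid_def[abs_def] mult.commute)
qed

text \<open>The normalisations differ on purpose. \<open>Fejer r\<close> has height one and tends to
  1 as \<open>r\<close> tends to 0, while its spectral density \<open>Tent r\<close> has mass one.
  \<open>VP r\<close> has integral one, so it concentrates for large \<open>r\<close> and spreads
  out for small \<open>r\<close>, while \<open>Trap r\<close> has height one.\<close>

definition Fejer :: "real \<Rightarrow> 'a::euclidean_space \<Rightarrow> real" where
  "Fejer r x = (\<Prod>b\<in>Basis. fejer (r * (x \<bullet> b)))"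

definition Tent :: "real \<Rightarrow> 'a::euclidean_space \<Rightarrow> real" where
  "Tent r \<xi> = (\<Prod>b\<in>Basis. tent (\<xi> \<bullet> b / r) / r)"

definition VP :: "real \<Rightarrow> 'a::euclidean_space \<Rightarrow> real" where
  "VP r x = (\<Prod>b\<in>Basis. r * vallee_poussin (r * (x \<bullet> b)))"

definition Trap :: "real \<Rightarrow> 'a::euclidean_space \<Rightarrow> real" where
  "Trap r \<xi> = (\<Prod>b\<in>Basis. trapezoid (\<xi> \<bullet> b / r))"

lemma fourier_pair_Tent: "r > 0 \<Longrightarrow> fourier_pair (Tent r) (Fejer r)"
  using fourier_pair_prod[OF fourier_pair_scale[OF fourier_pair_tent, of "1 / r"]]
  by (simp add: Tent_def[abs_def] Fejer_def[abs_def] mult.commute)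

lemma fourier_pair_VP: "r > 0 \<Longrightarrow> fourier_pair (VP r) (Trap r)"
  using fourier_pair_prod[OF fourier_pair_scale[OF fourier_pair_vallee_poussin, of r]]
  by (simp add: VP_def[abs_def] Trap_def[abs_def])

lemma fourier_pair_Trap:
  assumes "r > 0"
  shows "fourier_pair (Trap r) (\<lambda>x::'a::euclidean_space. (2 * pi) ^ DIM('a) * VP r x)"
proof -
  have s: "fourier_pair (\<lambda>x. 1/r * trapezoid (1/r * x)) (\<lambda>y. 2 * pi * vallee_poussin (y / (1/r)))"
    by (rule fourier_pair_scale[OF fourier_pair_trapezoid]) (use assms in simp)
  \<comment> \<open>Scaling attached a factor \<open>1/r\<close> to the trapezoid. A linear
    combination with second coefficient 0 is a scalar multiple, which removes that factor.\<close>
  have "fourier_pair (\<lambda>x. r * (1/r * trapezoid (1/r * x)) - 0 * (1/r * trapezoid (1/r * x)))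
      (\<lambda>y. r * (2 * pi * vallee_poussin (y / (1/r))) - 0 * (2 * pi * vallee_poussin (y / (1/r))))"
    by (rule fourier_pair_lincomb[OF s s])
  then have "fourier_pair (\<lambda>x. trapezoid (x / r)) (\<lambda>y. 2 * pi * (r * vallee_poussin (r * y)))"
    using assms by (simp add: mult_ac)
  from fourier_pair_prod[OF this] show ?thesis
    by (simp add: Trap_def[abs_def] VP_def[abs_def] prod.distrib)
qed

lemma fourier_pair_integrable: "fourier_pair p q \<Longrightarrow> integrable lborel p"
  by (simp add: fourier_pair_def)

lemma integrable_Fejer:
  assumes "r > 0"
  shows "integrable lborel (Fejer r :: 'a::euclidean_space \<Rightarrow> real)"
proof -
  have "integrable lborel (\<lambda>x. fejer (r * x))"
    using lborel_integrable_real_affine[OF integrable_fejer, of r 0] assms by simp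
  then show ?thesis
    unfolding Fejer_def[abs_def] by (intro integrable_lborel_prod)
qed

lemma Fejer_nonneg: "0 \<le> Fejer r x"
  by (simp add: Fejer_def prod_nonneg fejer_nonneg)

lemma Fejer_le_1: "Fejer r x \<le> 1"
  by (simp add: Fejer_def prod_le_1 fejer_nonneg fejer_le_1)

lemma borel_measurable_Fejer [measurable]: "Fejer r \<in> borel_measurable borel"
  unfolding Fejer_def[abs_def] by measurable

lemma tendsto_Fejer:
  fixes x :: "'a::euclidean_space"
  assumes "(r \<longlongrightarrow> 0) F"
  shows "((\<lambda>n. Fejer (r n) x) \<longlongrightarrow> 1) F"
proof -
  have "((\<lambda>n. Fejer (r n) x) \<longlongrightarrow> (\<Prod>b\<in>(Basis::'a set). fejer (0 * (x \<bullet> b)))) F"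
    unfolding Fejer_def
    by (intro tendsto_prod isCont_tendsto_compose[OF isCont_fejer] tendsto_intros assms)
  then show ?thesis by simp
qed

lemma Tent_eq_0: "r > 0 \<Longrightarrow> b \<in> Basis \<Longrightarrow> r \<le> \<bar>\<xi> \<bullet> b\<bar> \<Longrightarrow> Tent r \<xi> = 0"
  unfolding Tent_def by (rule prod_zero) (auto intro!: bexI[of _ b] tent_bounds(3) simp: field_simps)

lemma Trap_eq_1: "r > 0 \<Longrightarrow> (\<And>b. b \<in> Basis \<Longrightarrow> \<bar>\<xi> \<bullet> b\<bar> \<le> r) \<Longrightarrow> Trap r \<xi> = 1"
  unfolding Trap_def by (rule prod.neutral) (auto intro!: trapezoid_eq_1 simp: field_simps)

lemma Trap_eq_0: "r > 0 \<Longrightarrow> b \<in> Basis \<Longrightarrow> 2 * r \<le> \<bar>\<xi> \<bullet> b\<bar> \<Longrightarrow> Trap r \<xi> = 0"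
  unfolding Trap_def by (rule prod_zero) (auto intro!: bexI[of _ b] trapezoid_eq_0 simp: field_simps)

lemma isCont_VP: "isCont (VP r) x"
proof -
  have vp: "isCont vallee_poussin t" for t
    unfolding vallee_poussin_def by (intro continuous_intros isCont_o2[OF _ isCont_fejer]) auto
  show ?thesis
    unfolding VP_def isCont_def
    by (intro tendsto_prod tendsto_mult tendsto_const isCont_tendsto_compose[OF vp]
        tendsto_inner tendsto_ident_at)
qed

lemma borel_measurable_VP [measurable]: "VP r \<in> borel_measurable borel"
  by (intro borel_measurable_continuous_onI continuous_at_imp_continuous_on ballI isCont_VP)

lemma VP_scale: "VP r x = r ^ DIM('a) * VP 1 (r *\<^sub>R x)" for x :: "'a::euclidean_space"
  by (simp add: VP_def prod.distrib)

section \<open>Convolution and continuity of translations\<close>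

lemma nn_integral_lborel_shift:
  fixes f :: "'a::euclidean_space \<Rightarrow> ennreal"
  assumes [measurable]: "f \<in> borel_measurable borel"
  shows "(\<integral>\<^sup>+x. f (x - y) \<partial>lborel) = (\<integral>\<^sup>+x. f x \<partial>lborel)"
proof -
  have "(\<integral>\<^sup>+x. f x \<partial>lborel) = (\<integral>\<^sup>+x. f x \<partial>distr lborel borel ((+) (-y)))"
    by (simp only: lborel_distr_plus)
  also have "\<dots> = (\<integral>\<^sup>+x. f (x - y) \<partial>lborel)"
    by (subst nn_integral_distr) auto
  finally show ?thesis ..
qed

lemma nn_integral_lborel_scale:
  fixes f :: "'a::euclidean_space \<Rightarrow> ennreal"
  assumes [measurable]: "f \<in> borel_measurable borel" and "c > 0"
  shows "(\<integral>\<^sup>+x. f x \<partial>lborel) = (\<integral>\<^sup>+x. ennreal (c ^ DIM('a)) * f (c *\<^sub>R x) \<partial>lborel)"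
proof -
  have "(\<integral>\<^sup>+x. f x \<partial>lborel) = (\<integral>\<^sup>+x. f x \<partial>density (distr lborel borel (\<lambda>x. 0 + c *\<^sub>R x)) (\<lambda>_. \<bar>c\<bar>^DIM('a)))"
    using lborel_affine[of c "0::'a"] assms(2) by simp
  also have "\<dots> = (\<integral>\<^sup>+x. ennreal (c ^ DIM('a)) * f (c *\<^sub>R x) \<partial>lborel)"
    using assms(2) by (subst nn_integral_density, simp, simp, subst nn_integral_distr) auto
  finally show ?thesis .
qed

lemma lborel_distr_reflect: "distr lborel borel (\<lambda>y. x - y) = (lborel :: 'a::euclidean_space measure)"
  using lborel_affine[of "-1" x] by (simp add: density_1)

context
  fixes f :: "'a::euclidean_space \<Rightarrow> 'b::{banach,second_countable_topology}"
begin

lemma integral_lborel_shift: "(LINT x|lborel. f (x - y)) = (LINT x|lborel. f x)"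
  if [measurable]: "f \<in> borel_measurable borel"
proof -
  have "(LINT x|lborel. f x) = (LINT x|distr lborel borel ((+) (-y)). f x)"
    by (simp only: lborel_distr_plus)
  also have "\<dots> = (LINT x|lborel. f (x - y))"
    by (subst integral_distr) auto
  finally show ?thesis ..
qed

lemma integral_lborel_reflect: "(LINT y|lborel. f (x - y)) = (LINT y|lborel. f y)"
  if [measurable]: "f \<in> borel_measurable borel"
proof -
  have "(LINT x|lborel. f x) = (LINT x|distr lborel borel (\<lambda>y. x - y). f x)"
    by (simp only: lborel_distr_reflect)
  also have "\<dots> = (LINT y|lborel. f (x - y))"
    by (subst integral_distr) auto
  finally show ?thesis ..
qed

lemma integrable_lborel_shift:
  assumes "integrable lborel f"
  shows "integrable lborel (\<lambda>x. f (x - y))"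
proof -
  have "integrable (distr lborel borel ((+) (-y))) f"
    using assms by (simp only: lborel_distr_plus)
  then show ?thesis
    using assms by (subst (asm) integrable_distr_eq) auto
qed

end

section \<open>Convolution and the transform without its constant\<close>

definition conv :: "('a::euclidean_space \<Rightarrow> complex) \<Rightarrow> ('a \<Rightarrow> complex) \<Rightarrow> 'a \<Rightarrow> complex" where
  "conv u w x = (LINT y|lborel. u y * w (x - y))"

definition ft :: "('a::euclidean_space \<Rightarrow> complex) \<Rightarrow> 'a \<Rightarrow> complex" where
  "ft u \<xi> = (LINT x|lborel. cis (- (\<xi> \<bullet> x)) * u x)"

lemma integrable_bounded_mult:
  fixes f u :: "'a \<Rightarrow> complex"
  assumes "integrable M u" "f \<in> borel_measurable M" "\<And>x. norm (f x) \<le> C"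
  shows "integrable M (\<lambda>x. f x * u x)"
proof (rule Bochner_Integration.integrable_bound)
  show "integrable M (\<lambda>x. C * norm (u x))"
    using assms(1) by simp
  have "0 \<le> C" using assms(3) norm_ge_zero order_trans by blast
  then show "AE x in M. norm (f x * u x) \<le> norm (C * norm (u x))"
    by (auto simp: norm_mult intro!: mult_right_mono assms(3))
qed (use assms in auto)

lemma conv_commute:
  assumes [measurable]: "u \<in> borel_measurable borel" "w \<in> borel_measurable borel"
  shows "conv u w = conv w u"
proof
  fix x
  show "conv u w x = conv w u x"
    unfolding conv_def
    using integral_lborel_reflect[of "\<lambda>y. u y * w (x - y)" x] by (simp add: mult.commute)
qed

lemma integrable_conv_pair:
  fixes u w :: "'a::euclidean_space \<Rightarrow> complex"
  assumes u: "integrable lborel u" and w: "integrable lborel w"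
  shows "integrable (lborel \<Otimes>\<^sub>M lborel) (\<lambda>(y, x). u y * w (x - y))"
proof (rule lborel_pair.Fubini_integrable)
  have [measurable]: "u \<in> borel_measurable borel" "w \<in> borel_measurable borel"
    using u w by auto
  show "(\<lambda>(y, x). u y * w (x - y)) \<in> borel_measurable (lborel \<Otimes>\<^sub>M lborel)"
    by measurable
  have "(LINT x|lborel. norm (u y * w (x - y))) = norm (u y) * (LINT x|lborel. norm (w x))" for y
    using integral_lborel_shift[of "\<lambda>x. norm (w x)" y] by (simp add: norm_mult)
  then show "integrable lborel (\<lambda>y. LINT x|lborel. norm (case (y, x) of (y, x) \<Rightarrow> u y * w (x - y)))"
    using u by simp
  show "AE y in lborel. integrable lborel (\<lambda>x. case (y, x) of (y, x) \<Rightarrow> u y * w (x - y))"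
    using integrable_lborel_shift[OF w] by simp
qed

lemma integrable_conv:
  assumes "integrable lborel u" "integrable lborel w"
  shows "integrable lborel (conv u w)"
  using lborel_pair.integrable_snd[OF integrable_conv_pair[OF assms]] by (simp add: conv_def[abs_def])

lemma integral_mult_conv:
  fixes u w :: "'a::euclidean_space \<Rightarrow> complex"
  assumes u: "integrable lborel u" and w: "integrable lborel w"
    and [measurable]: "f \<in> borel_measurable borel" and C: "\<And>x. norm (f x) \<le> C"
  shows "(LINT x|lborel. f x * conv u w x) = (LINT y|lborel. u y * (LINT x|lborel. f x * w (x - y)))"
proof -
  have "integrable (lborel \<Otimes>\<^sub>M lborel) (\<lambda>z. f (snd z) * (case z of (y, x) \<Rightarrow> u y * w (x - y)))"
    by (rule integrable_bounded_mult[OF integrable_conv_pair[OF u w], where C=C]) (use C in auto)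
  then have "integrable (lborel \<Otimes>\<^sub>M lborel) (\<lambda>(y, x). f x * (u y * w (x - y)))"
    by (simp add: case_prod_beta')
  from lborel_pair.Fubini_integral[OF this] show ?thesis
    unfolding conv_def by (simp add: mult.left_commute flip: integral_mult_right_zero)
qed

lemma ft_shift:
  assumes "integrable lborel w"
  shows "(LINT x|lborel. cis (- (\<xi> \<bullet> x)) * w (x - y)) = cis (- (\<xi> \<bullet> y)) * ft w \<xi>"
proof -
  have [measurable]: "w \<in> borel_measurable borel" using assms by auto
  have "(LINT x|lborel. cis (- (\<xi> \<bullet> x)) * w (x - y)) =
      (LINT x|lborel. (\<lambda>x. cis (- (\<xi> \<bullet> y)) * (cis (- (\<xi> \<bullet> x)) * w x)) (x - y))"
    by (intro Bochner_Integration.integral_cong refl)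
       (simp add: cis_mult inner_diff_right flip: mult.assoc)
  also have "\<dots> = (LINT x|lborel. cis (- (\<xi> \<bullet> y)) * (cis (- (\<xi> \<bullet> x)) * w x))"
    by (rule integral_lborel_shift) measurable
  finally show ?thesis by (simp add: ft_def)
qed

lemma ft_conv:
  assumes "integrable lborel u" "integrable lborel w"
  shows "ft (conv u w) \<xi> = ft u \<xi> * ft w \<xi>"
proof -
  have "ft (conv u w) \<xi> = (LINT y|lborel. u y * (cis (- (\<xi> \<bullet> y)) * ft w \<xi>))"
    unfolding ft_def[of "conv u w"] ft_shift[OF assms(2), symmetric]
    by (rule integral_mult_conv[OF assms, where C=1]) auto
  then show ?thesis
    by (simp add: ft_def mult_ac flip: integral_mult_left_zero)
qed

text \<open>Fubini for an absolutely convergent double integral: \<open>u\<close> is integrable in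
  space, \<open>\<tau>\<close> in frequency, and \<open>ft u\<close> is only bounded. It reads off
  convolutions on the frequency side whenever the kernel is given as an inverse transform.\<close>

lemma conv_inverse_ft:
  fixes u \<tau> :: "'a::euclidean_space \<Rightarrow> complex"
  assumes u: "integrable lborel u" and \<tau>: "integrable lborel \<tau>"
  shows "conv u (\<lambda>x. LINT \<xi>|lborel. cis (\<xi> \<bullet> x) * \<tau> \<xi>) x = (LINT \<xi>|lborel. cis (\<xi> \<bullet> x) * (\<tau> \<xi> * ft u \<xi>))"
proof -
  have [measurable]: "u \<in> borel_measurable borel" "\<tau> \<in> borel_measurable borel"
    using u \<tau> by auto
  have "integrable (lborel \<Otimes>\<^sub>M lborel) (\<lambda>(y, \<xi>). u y * (cis (\<xi> \<bullet> (x - y)) * \<tau> \<xi>))"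
  proof (rule lborel_pair.Fubini_integrable)
    show "integrable lborel (\<lambda>y. LINT \<xi>|lborel. norm (case (y, \<xi>) of (y, \<xi>) \<Rightarrow> u y * (cis (\<xi> \<bullet> (x - y)) * \<tau> \<xi>)))"
      using u by (simp add: norm_mult)
    show "AE y in lborel. integrable lborel (\<lambda>\<xi>. case (y, \<xi>) of (y, \<xi>) \<Rightarrow> u y * (cis (\<xi> \<bullet> (x - y)) * \<tau> \<xi>))"
      using integrable_bounded_mult[OF \<tau>, of "\<lambda>\<xi>. cis (\<xi> \<bullet> (x - y))" 1 for y] by simp
  qed measurable
  from lborel_pair.Fubini_integral[OF this]
  have "conv u (\<lambda>x. LINT \<xi>|lborel. cis (\<xi> \<bullet> x) * \<tau> \<xi>) x =
      (LINT \<xi>|lborel. (LINT y|lborel. u y * (cis (\<xi> \<bullet> (x - y)) * \<tau> \<xi>)))"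
    by (simp add: conv_def)
  also have "\<dots> = (LINT \<xi>|lborel. (LINT y|lborel. (cis (\<xi> \<bullet> x) * \<tau> \<xi>) * (cis (- (\<xi> \<bullet> y)) * u y)))"
  proof (intro Bochner_Integration.integral_cong refl)
    fix \<xi> y
    have "cis (\<xi> \<bullet> (x - y)) = cis (\<xi> \<bullet> x) * cis (- (\<xi> \<bullet> y))"
      by (simp add: cis_mult inner_diff_right)
    then show "u y * (cis (\<xi> \<bullet> (x - y)) * \<tau> \<xi>) = (cis (\<xi> \<bullet> x) * \<tau> \<xi>) * (cis (- (\<xi> \<bullet> y)) * u y)"
      by (simp add: mult_ac)
  qed
  finally show ?thesis by (simp add: ft_def mult.assoc)
qed

text \<open>The modulus of continuity of \<open>w\<close> in L^1. Values in \<open>ennreal\<close>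
  let Tonelli be applied before anything is known to be finite.\<close>

definition shift_dist :: "('a::euclidean_space \<Rightarrow> complex) \<Rightarrow> 'a \<Rightarrow> ennreal" where
  "shift_dist w y = (\<integral>\<^sup>+x. norm (w (x - y) - w x) \<partial>lborel)"

lemma borel_measurable_shift_dist [measurable]:
  assumes [measurable]: "w \<in> borel_measurable borel"
  shows "shift_dist w \<in> borel_measurable borel"
  unfolding shift_dist_def[abs_def] by measurable

text \<open>The character factors out of the convolution as \<open>cis (\<eta> \<bullet> x)\<close>
  times an integral of \<open>cis (- (\<eta> \<bullet> y)) * u y * w (x - y)\<close>. Replacing
  \<open>w (x - y)\<close> by \<open>w x\<close> there produces \<open>ft u \<eta>\<close>, and the
  error involves characters only through their modulus, so the bound is free of
  \<open>\<eta>\<close>.\<close>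

lemma conv_modulation_approx:
  fixes u w :: "'a::euclidean_space \<Rightarrow> complex"
  assumes u: "integrable lborel u" and w: "integrable lborel w"
  shows "(\<integral>\<^sup>+x. norm (ft u \<eta> * (cis (\<eta> \<bullet> x) * w x) - conv u (\<lambda>x. cis (\<eta> \<bullet> x) * w x) x) \<partial>lborel)
     \<le> (\<integral>\<^sup>+y. norm (u y) * shift_dist w y \<partial>lborel)"
proof -
  have [measurable]: "u \<in> borel_measurable borel" "w \<in> borel_measurable borel"
    using u w by auto
  have "AE x in lborel. integrable lborel (\<lambda>y. u y * w (x - y))"
    using lborel_pair.AE_integrable_snd[OF integrable_conv_pair[OF u w]] .
  then have "AE x in lborel. ennreal (norm (ft u \<eta> * (cis (\<eta> \<bullet> x) * w x) - conv u (\<lambda>x. cis (\<eta> \<bullet> x) * w x) x))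
      \<le> (\<integral>\<^sup>+y. ennreal (norm (u y)) * ennreal (norm (w (x - y) - w x)) \<partial>lborel)"
  proof eventually_elim
    case (elim x)
    have e: "cis (\<eta> \<bullet> (x - y)) = cis (\<eta> \<bullet> x) * cis (- (\<eta> \<bullet> y))" for y
      by (simp add: cis_mult inner_diff_right)
    have 1: "integrable lborel (\<lambda>y. (cis (\<eta> \<bullet> x) * w x) * (cis (- (\<eta> \<bullet> y)) * u y))"
      by (intro integrable_mult_right, rule integrable_bounded_mult[OF u, where C=1]) auto
    have 2: "integrable lborel (\<lambda>y. cis (\<eta> \<bullet> x) * (cis (- (\<eta> \<bullet> y)) * (u y * w (x - y))))"
      by (intro integrable_mult_right, rule integrable_bounded_mult[OF elim, where C=1]) auto
    have "conv u (\<lambda>x. cis (\<eta> \<bullet> x) * w x) x = (LINT y|lborel. cis (\<eta> \<bullet> x) * (cis (- (\<eta> \<bullet> y)) * (u y * w (x - y))))"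
      unfolding conv_def e by (simp add: mult_ac)
    moreover have "ft u \<eta> * (cis (\<eta> \<bullet> x) * w x) = (LINT y|lborel. (cis (\<eta> \<bullet> x) * w x) * (cis (- (\<eta> \<bullet> y)) * u y))"
      by (simp add: ft_def)
    ultimately have 3: "ft u \<eta> * (cis (\<eta> \<bullet> x) * w x) - conv u (\<lambda>x. cis (\<eta> \<bullet> x) * w x) x =
       (LINT y|lborel. (cis (\<eta> \<bullet> x) * w x) * (cis (- (\<eta> \<bullet> y)) * u y) - cis (\<eta> \<bullet> x) * (cis (- (\<eta> \<bullet> y)) * (u y * w (x - y))))"
      by (simp only: Bochner_Integration.integral_diff[OF 1 2])
    have "ennreal (norm (ft u \<eta> * (cis (\<eta> \<bullet> x) * w x) - conv u (\<lambda>x. cis (\<eta> \<bullet> x) * w x) x)) \<le> (\<integral>\<^sup>+y. norm ((cis (\<eta> \<bullet> x) * w x) * (cis (- (\<eta> \<bullet> y)) * u y) - cis (\<eta> \<bullet> x) * (cis (- (\<eta> \<bullet> y)) * (u y * w (x - y)))) \<partial>lborel)"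
      unfolding 3 by (intro integral_norm_bound_ennreal Bochner_Integration.integrable_diff 1 2)
    also have "\<dots> = (\<integral>\<^sup>+y. ennreal (norm (u y)) * ennreal (norm (w (x - y) - w x)) \<partial>lborel)"
    proof (rule nn_integral_cong)
      fix y
      have "(cis (\<eta> \<bullet> x) * w x) * (cis (- (\<eta> \<bullet> y)) * u y) - cis (\<eta> \<bullet> x) * (cis (- (\<eta> \<bullet> y)) * (u y * w (x - y)))
        = cis (\<eta> \<bullet> x) * (cis (- (\<eta> \<bullet> y)) * (u y * (w x - w (x - y))))"
        by (simp only: right_diff_distrib mult_ac)
      then show "ennreal (norm ((cis (\<eta> \<bullet> x) * w x) * (cis (- (\<eta> \<bullet> y)) * u y) - cis (\<eta> \<bullet> x) * (cis (- (\<eta> \<bullet> y)) * (u y * w (x - y)))))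
        = ennreal (norm (u y)) * ennreal (norm (w (x - y) - w x))"
        by (simp only: norm_mult norm_cis mult_1_left norm_minus_commute[of "w x"] ennreal_mult[OF norm_ge_zero norm_ge_zero])
    qed
    finally show ?case .
  qed
  then have "(\<integral>\<^sup>+x. norm (ft u \<eta> * (cis (\<eta> \<bullet> x) * w x) - conv u (\<lambda>x. cis (\<eta> \<bullet> x) * w x) x) \<partial>lborel)
    \<le> (\<integral>\<^sup>+x. (\<integral>\<^sup>+y. ennreal (norm (u y)) * ennreal (norm (w (x - y) - w x)) \<partial>lborel) \<partial>lborel)"
    by (rule nn_integral_mono_AE)
  also have "\<dots> = (\<integral>\<^sup>+y. (\<integral>\<^sup>+x. ennreal (norm (u y)) * ennreal (norm (w (x - y) - w x)) \<partial>lborel) \<partial>lborel)"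
    by (rule lborel_pair.Fubini') measurable
  also have "\<dots> = (\<integral>\<^sup>+y. norm (u y) * shift_dist w y \<partial>lborel)"
    by (simp add: shift_dist_def nn_integral_cmult)
  finally show ?thesis .
qed

text \<open>Scheffe's lemma: the translates converge almost everywhere by continuity, and all have
  the same norm. Almost everywhere continuity covers both the smooth kernels and indicators of
  boxes.\<close>

lemma shift_dist_tendsto_0:
  fixes w :: "'a::euclidean_space \<Rightarrow> complex"
  assumes w: "integrable lborel w" and c: "AE x in lborel. isCont w x" and y: "y \<longlonglongrightarrow> 0"
  shows "(\<lambda>n. shift_dist w (y n)) \<longlonglongrightarrow> 0"
  unfolding shift_dist_def
proof (rule Scheffe_lemma2[OF _ w])
  have [measurable]: "w \<in> borel_measurable borel" using w by auto
  show "(\<lambda>x. w (x - y n)) \<in> borel_measurable lborel" for n by measurable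
  show "AE x in lborel. (\<lambda>n. w (x - y n)) \<longlonglongrightarrow> w x"
    using c
  proof eventually_elim
    case (elim x)
    show ?case
      by (rule isCont_tendsto_compose[OF elim]) (use tendsto_diff[OF tendsto_const[of x] y] in simp)
  qed
  show "(\<integral>\<^sup>+x. norm (w (x - y n)) \<partial>lborel) \<le> (\<integral>\<^sup>+x. norm (w x) \<partial>lborel)" for n
    using nn_integral_lborel_shift[of "\<lambda>x. ennreal (norm (w x))" "y n"] by simp
qed

lemma shift_dist_le:
  fixes w :: "'a::euclidean_space \<Rightarrow> complex"
  assumes [measurable]: "w \<in> borel_measurable borel"
  shows "shift_dist w y \<le> 2 * (\<integral>\<^sup>+x. norm (w x) \<partial>lborel)"
proof -
  have "shift_dist w y \<le> (\<integral>\<^sup>+x. ennreal (norm (w (x - y))) + ennreal (norm (w x)) \<partial>lborel)"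
    unfolding shift_dist_def
    by (intro nn_integral_mono) (simp add: norm_triangle_ineq4 flip: ennreal_plus)
  also have "\<dots> = 2 * (\<integral>\<^sup>+x. norm (w x) \<partial>lborel)"
    using nn_integral_lborel_shift[of "\<lambda>x. ennreal (norm (w x))" y]
    by (simp add: nn_integral_add mult_2)
  finally show ?thesis .
qed

text \<open>Dominated convergence in \<open>y\<close>: for fixed \<open>y\<close> the shift tends to
  0, and twice the norm of \<open>w\<close> bounds every shift.\<close>

lemma weighted_shift_dist_tendsto_0:
  fixes u w :: "'a::euclidean_space \<Rightarrow> complex" and r :: "nat \<Rightarrow> real"
  assumes u: "integrable lborel u" and w: "integrable lborel w"
    and c: "AE x in lborel. isCont w x" and r: "r \<longlonglongrightarrow> 0"
  shows "(\<lambda>n. \<integral>\<^sup>+y. norm (u y) * shift_dist w (r n *\<^sub>R y) \<partial>lborel) \<longlonglongrightarrow> 0"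
proof -
  have [measurable]: "u \<in> borel_measurable borel" "w \<in> borel_measurable borel"
    using u w by auto
  let ?N = "\<integral>\<^sup>+x. norm (w x) \<partial>lborel"
  have N: "?N < \<infinity>" using w by (simp add: integrable_iff_bounded)
  have "(\<lambda>n. \<integral>\<^sup>+y. norm (u y) * shift_dist w (r n *\<^sub>R y) \<partial>lborel) \<longlonglongrightarrow> (\<integral>\<^sup>+y. 0 \<partial>(lborel :: 'a measure))"
  proof (rule nn_integral_dominated_convergence[where w="\<lambda>y. norm (u y) * (2 * ?N)"])
    show "(\<integral>\<^sup>+y. norm (u y) * (2 * ?N) \<partial>lborel) < \<infinity>"
      using u N by (simp add: nn_integral_multc integrable_iff_bounded ennreal_mult_less_top)
    show "AE y in lborel. ennreal (norm (u y)) * shift_dist w (r n *\<^sub>R y) \<le> ennreal (norm (u y)) * (2 * ?N)" for n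
      by (intro AE_I2 mult_left_mono shift_dist_le) auto
    show "AE y in lborel. (\<lambda>n. ennreal (norm (u y)) * shift_dist w (r n *\<^sub>R y)) \<longlonglongrightarrow> 0"
    proof (rule AE_I2)
      fix y :: 'a
      have "(\<lambda>n. r n *\<^sub>R y) \<longlonglongrightarrow> 0"
        using tendsto_scaleR[OF r tendsto_const, of y] by simp
      from ennreal_tendsto_cmult[OF _ shift_dist_tendsto_0[OF w c this], of "ennreal (norm (u y))"]
      show "(\<lambda>n. ennreal (norm (u y)) * shift_dist w (r n *\<^sub>R y)) \<longlonglongrightarrow> 0" by simp
    qed
  qed measurable
  then show ?thesis by simp
qed

section \<open>Bump functions\<close>

text \<open>The negative powers of \<open>t\<close> are carried along because differentiating
  \<open>exp (- inverse t)\<close> creates them; the derivative of \<open>rho j\<close> is again a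
  combination of \<open>rho (j + 1)\<close> and \<open>rho (j + 2)\<close>.\<close>

definition rho :: "nat \<Rightarrow> real \<Rightarrow> real" where
  "rho j t = (if t \<le> 0 then 0 else inverse t ^ j * exp (- inverse t))"

lemma rho_at_right: "(rho j \<longlongrightarrow> 0) (at_right 0)"
proof -
  have "((\<lambda>t. (\<lambda>s. s ^ j / exp s) (inverse t)) \<longlongrightarrow> 0) (at_right (0::real))"
    by (rule filterlim_compose[OF tendsto_power_div_exp_0 filterlim_inverse_at_top_right])
  moreover have "\<forall>\<^sub>F t in at_right (0::real). (\<lambda>s. s ^ j / exp s) (inverse t) = rho j t"
    by (simp add: rho_def exp_minus divide_inverse eventually_at_filter)
  ultimately show ?thesis
    by (rule Lim_transform_eventually)
qed

lemma DERIV_rho: "(rho j has_real_derivative rho (j + 2) t - real j * rho (j + 1) t) (at t)"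
proof -
  consider "t < 0" | "t = 0" | "t > 0" by linarith
  then show ?thesis
  proof cases
    case 1
    have "((\<lambda>_. 0) has_real_derivative 0) (at t)" by simp
    then have "(rho j has_real_derivative 0) (at t)"
      by (rule has_field_derivative_transform_within_open[of _ _ _ "{..<0}"])
         (use 1 in \<open>auto simp: rho_def\<close>)
    then show ?thesis using 1 by (simp add: rho_def)
  next
    case 2
    \<comment> \<open>On the right of 0 the difference quotient is \<open>rho (Suc j)\<close>:
      dividing by \<open>h\<close> raises the power of \<open>inverse h\<close> by one.\<close>
    have r: "((\<lambda>h. (rho j h - rho j 0) / (h - 0)) \<longlongrightarrow> 0) (at_right 0)"
      by (rule Lim_transform_eventually[OF rho_at_right[of "Suc j"]])
         (auto simp: rho_def eventually_at_filter divide_inverse)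
    have l: "((\<lambda>h. (rho j h - rho j 0) / (h - 0)) \<longlongrightarrow> 0) (at_left 0)"
      by (rule Lim_transform_eventually[OF tendsto_const[of 0]])
         (auto simp: rho_def eventually_at_filter)
    show ?thesis
      unfolding 2 has_field_derivative_iff using filterlim_split_at[OF l r] by (simp add: rho_def)
  next
    case 3
    have i: "(inverse has_real_derivative - (inverse t ^ 2)) (at t)"
      using 3 DERIV_inverse[of t] by (simp add: numeral_2_eq_2)
    have e: "((\<lambda>t. exp (- inverse t)) has_real_derivative exp (- inverse t) * inverse t ^ 2) (at t)"
      using DERIV_fun_exp[OF DERIV_minus[OF i]] by simp
    have "((\<lambda>t. inverse t ^ j * exp (- inverse t)) has_real_derivative
       rho (j + 2) t - real j * rho (j + 1) t) (at t)"
      by (rule DERIV_cong[OF DERIV_mult[OF DERIV_power[OF i, of j] e]])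
         (use 3 in \<open>cases j; simp add: rho_def algebra_simps power2_eq_square\<close>)
    then show ?thesis
      by (rule has_field_derivative_transform_within_open[of _ _ _ "{0<..}"])
         (use 3 in \<open>auto simp: rho_def\<close>)
  qed
qed

text \<open>Closed under partial derivatives, so that every iterated partial derivative of a bump function
  is again differentiable.\<close>

inductive bump_algebra :: "('a::euclidean_space \<Rightarrow> real) \<Rightarrow> bool" where
  const: "bump_algebra (\<lambda>x. c)"
| inner: "bump_algebra (\<lambda>x. x \<bullet> v)"
| rho: "bump_algebra (\<lambda>x. rho j (d - (x - a) \<bullet> (x - a)))"
| add: "bump_algebra f \<Longrightarrow> bump_algebra g \<Longrightarrow> bump_algebra (\<lambda>x. f x + g x)"
| mult: "bump_algebra f \<Longrightarrow> bump_algebra g \<Longrightarrow> bump_algebra (\<lambda>x. f x * g x)"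

lemma bump_algebra_derivative:
  assumes "bump_algebra f"
  shows "\<exists>f'. (\<forall>x. (f has_derivative f' x) (at x)) \<and> (\<forall>v. bump_algebra (\<lambda>x. f' x v))"
  using assms
proof induction
  case (const c)
  show ?case
    by (rule exI[of _ "\<lambda>x v. 0"]) (auto intro: bump_algebra.intros)
next
  case (inner w)
  show ?case
    by (rule exI[of _ "\<lambda>x v. v \<bullet> w"]) (auto intro: bump_algebra.intros derivative_eq_intros)
next
  case (rho j d a)
  let ?q = "\<lambda>x. d - (x - a) \<bullet> (x - a)"
  \<comment> \<open>Subtraction is spelled as addition with negative constants, so that the
    introduction rules of \<open>bump_algebra\<close> apply as they stand.\<close>
  let ?f' = "\<lambda>x v. (rho (j + 2) (?q x) + (- real j) * rho (j + 1) (?q x)) * ((- 2) * (x \<bullet> v) + 2 * (a \<bullet> v))"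
  have "((\<lambda>x. rho j (?q x)) has_derivative ?f' x) (at x)" for x
  proof -
    have "(?q has_derivative (\<lambda>v. (- 2) * (x \<bullet> v) + 2 * (a \<bullet> v))) (at x)"
      by (auto intro!: derivative_eq_intros simp: inner_diff_left inner_diff_right inner_commute)
    from has_derivative_compose[OF this DERIV_rho[of j "?q x", unfolded has_field_derivative_def]]
    show ?thesis by simp
  qed
  moreover have "bump_algebra (\<lambda>x. ?f' x v)" for v
    by (intro bump_algebra.intros)
  ultimately show ?case by (intro exI[of _ ?f']) simp
next
  case (add f g)
  then obtain f' g' where "\<forall>x. (f has_derivative f' x) (at x)" "\<forall>v. bump_algebra (\<lambda>x. f' x v)"
    "\<forall>x. (g has_derivative g' x) (at x)" "\<forall>v. bump_algebra (\<lambda>x. g' x v)"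
    by blast
  then show ?case
    by (intro exI[of _ "\<lambda>x v. f' x v + g' x v"]) (auto intro: bump_algebra.intros has_derivative_add)
next
  case (mult f g)
  then obtain f' g' where "\<forall>x. (f has_derivative f' x) (at x)" "\<forall>v. bump_algebra (\<lambda>x. f' x v)"
    "\<forall>x. (g has_derivative g' x) (at x)" "\<forall>v. bump_algebra (\<lambda>x. g' x v)"
    by blast
  with mult.hyps show ?case
    by (intro exI[of _ "\<lambda>x v. f x * g' x v + f' x v * g x"]) (auto intro!: bump_algebra.intros has_derivative_mult)
qed

lemma iter_deriv_bump_algebra:
  assumes "bump_algebra f"
  shows "\<exists>g. bump_algebra g \<and> iter_deriv vs (\<lambda>x. complex_of_real (f x)) = (\<lambda>x. complex_of_real (g x))"
proof (induction vs)
  case Nil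
  then show ?case using assms by auto
next
  case (Cons v vs)
  then obtain g where g: "bump_algebra g"
    "iter_deriv vs (\<lambda>x. complex_of_real (f x)) = (\<lambda>x. complex_of_real (g x))" by blast
  obtain g' where g': "\<forall>x. (g has_derivative g' x) (at x)" "\<forall>v. bump_algebra (\<lambda>x. g' x v)"
    using bump_algebra_derivative[OF g(1)] by blast
  have "((\<lambda>x. complex_of_real (g x)) has_derivative (\<lambda>v. complex_of_real (g' x v))) (at x)" for x
    using g'(1) by (auto intro: has_derivative_of_real)
  from frechet_derivative_at[OF this, symmetric]
  have "iter_deriv (v # vs) (\<lambda>x. complex_of_real (f x)) = (\<lambda>x. complex_of_real (g' x v))"
    by (simp add: g(2))
  then show ?case using g'(2) by blast
qed

definition bump :: "real \<Rightarrow> 'a::euclidean_space \<Rightarrow> 'a \<Rightarrow> complex" where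
  "bump \<delta> a x = complex_of_real (rho 0 (\<delta>\<^sup>2 - (x - a) \<bullet> (x - a)))"

lemma bump_support:
  assumes "\<delta> > 0"
  shows "bump \<delta> a x \<noteq> 0 \<longleftrightarrow> x \<in> ball a \<delta>"
proof -
  have "bump \<delta> a x \<noteq> 0 \<longleftrightarrow> (norm (x - a))\<^sup>2 < \<delta>\<^sup>2"
    by (simp add: bump_def rho_def dot_square_norm)
  also have "\<dots> \<longleftrightarrow> norm (x - a) < \<delta>"
    using assms by (meson less_imp_le norm_ge_zero power_less_imp_less_base power_strict_mono zero_less_numeral)
  finally show ?thesis
    by (simp add: dist_norm norm_minus_commute)
qed

lemma test_fun_bump: "\<delta> > 0 \<Longrightarrow> test_fun (bump \<delta> (a::'a::euclidean_space))"
  unfolding test_fun_def smooth_fun_def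
proof (intro conjI allI impI)
  fix vs :: "'a list" and x
  obtain g :: "'a \<Rightarrow> real" where g: "bump_algebra g" "iter_deriv vs (bump \<delta> a) = (\<lambda>x. complex_of_real (g x))"
    using iter_deriv_bump_algebra[OF bump_algebra.rho[of 0 "\<delta>\<^sup>2" a]]
    unfolding bump_def[abs_def] by blast
  obtain g' where "(g has_derivative g') (at x)"
    using bump_algebra_derivative[OF g(1)] by blast
  from has_derivative_of_real[OF this, where ?'a=complex]
  show "iter_deriv vs (bump \<delta> a) differentiable at x"
    unfolding g(2) differentiable_def by blast
next
  assume "\<delta> > 0"
  then have "{x. bump \<delta> a x \<noteq> 0} = ball a \<delta>"
    using bump_support by blast
  then show "compact (closure {x. bump \<delta> a x \<noteq> 0})"
    by simp
qed

lemma isCont_bump: "isCont (bump \<delta> a) x"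
proof -
  have c: "isCont (rho 0) t" for t
    using DERIV_isCont[OF DERIV_rho] .
  show ?thesis
    unfolding bump_def isCont_def by (intro tendsto_of_real isCont_tendsto_compose[OF c] tendsto_intros)
qed

lemma integrable_bump:
  assumes "\<delta> > 0"
  shows "integrable lborel (bump \<delta> (a::'a::euclidean_space))"
proof -
  have "integrable lborel (\<lambda>x. indicator (cball a \<delta>) x *\<^sub>R bump \<delta> a x)"
    by (rule borel_integrable_compact)
       (auto intro!: continuous_at_imp_continuous_on isCont_bump)
  also have "(\<lambda>x. indicator (cball a \<delta>) x *\<^sub>R bump \<delta> a x) = bump \<delta> a"
  proof
    fix x
    show "indicator (cball a \<delta>) x *\<^sub>R bump \<delta> a x = bump \<delta> a x"
      using bump_support[OF assms, of a x] by (cases "dist a x \<le> \<delta>") (auto simp: indicator_def)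
  qed
  finally show ?thesis .
qed

lemma bump_shift: "bump \<delta> a x = bump \<delta> 0 (x - a)"
  unfolding bump_def diff_zero ..

text \<open>On the support of the bump the phase is at most
  \<open>\<delta> * norm \<xi> \<le> 1 < pi / 2\<close> in absolute value, so the cosine is positive
  there. A vanishing real part would make the ball of radius \<open>\<delta>\<close> a null
  set.\<close>

lemma ft_bump_nonzero:
  fixes \<xi> :: "'a::euclidean_space"
  assumes "\<delta> > 0" "\<delta> * norm \<xi> \<le> 1"
  shows "ft (bump \<delta> 0) \<xi> \<noteq> 0"
proof
  assume 0: "ft (bump \<delta> 0) \<xi> = 0"
  let ?r = "\<lambda>x::'a. rho 0 (\<delta>\<^sup>2 - x \<bullet> x)"
  have int: "integrable lborel (\<lambda>x. cis (- (\<xi> \<bullet> x)) * bump \<delta> 0 x)"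
    by (rule integrable_bounded_mult[OF integrable_bump[OF assms(1)], where C=1]) auto
  have Re: "Re (cis (- (\<xi> \<bullet> x)) * bump \<delta> 0 x) = cos (\<xi> \<bullet> x) * ?r x" for x
    by (simp add: bump_def)
  have pos: "cos (\<xi> \<bullet> x) > 0" if "x \<in> ball 0 \<delta>" for x
  proof -
    have "\<bar>\<xi> \<bullet> x\<bar> \<le> norm \<xi> * norm x" by (rule Cauchy_Schwarz_ineq2)
    also have "\<dots> \<le> norm \<xi> * \<delta>" using that by (intro mult_left_mono) auto
    also have "\<dots> \<le> 1" using assms by (simp add: mult.commute)
    finally have "\<bar>\<xi> \<bullet> x\<bar> < pi / 2" using pi_gt3 by linarith
    then show ?thesis by (intro cos_gt_zero_pi) auto
  qed
  have supp: "?r x > 0 \<longleftrightarrow> x \<in> ball 0 \<delta>" "0 \<le> ?r x" "x \<notin> ball 0 \<delta> \<Longrightarrow> ?r x = 0" for x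
    using bump_support[OF assms(1), of 0 x] by (auto simp: bump_def rho_def)
  have z: "(LINT x|lborel. cos (\<xi> \<bullet> x) * ?r x) = 0"
    using integral_Re[OF int] 0 unfolding Re ft_def by simp
  have i: "integrable lborel (\<lambda>x. cos (\<xi> \<bullet> x) * ?r x)"
    using integrable_Re[OF int] by (simp only: Re)
  have nn: "0 \<le> cos (\<xi> \<bullet> x) * ?r x" for x
  proof (cases "x \<in> ball 0 \<delta>")
    case True
    then show ?thesis by (intro mult_nonneg_nonneg supp(2) less_imp_le[OF pos])
  next
    case False
    then show ?thesis by (simp only: supp(3)[OF False] mult_zero_right order_refl)
  qed
  have "AE x in lborel. cos (\<xi> \<bullet> x) * ?r x = 0"
    using z integral_nonneg_eq_0_iff_AE[OF i AE_I2[OF nn]] by blast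
  then have "AE x in lborel. x \<notin> ball (0::'a) \<delta>"
  proof eventually_elim
    case (elim x)
    show ?case
    proof
      assume "x \<in> ball 0 \<delta>"
      with pos supp(1) have "0 < cos (\<xi> \<bullet> x) * ?r x" by (intro mult_pos_pos) blast+
      with elim show False by linarith
    qed
  qed
  then have "ball (0::'a) \<delta> \<in> null_sets lborel"
    by (subst AE_iff_null_sets) simp_all
  then have "negligible (ball (0::'a) \<delta>)"
    by (simp add: negligible_iff_null_sets null_sets_completionI)
  then show False
    using open_not_negligible[of "ball (0::'a) \<delta>"] assms(1) by simp
qed

lemma fourier_eq_ft:
  fixes u :: "'a::euclidean_space \<Rightarrow> complex"
  assumes [measurable]: "u \<in> borel_measurable borel"
  shows "fourier u \<xi> = complex_of_real ((2 * pi) powr (- real DIM('a))) * ft u \<xi>"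
proof -
  have "(LINT x|lebesgue. cis (- (x \<bullet> \<xi>)) * u x) = (LINT x|lborel. cis (- (x \<bullet> \<xi>)) * u x)"
    by (rule integral_completion) measurable
  then show ?thesis
    unfolding fourier_def ft_def by (simp only: inner_commute)
qed

section \<open>Spectral localisation\<close>

lemma ft_fourier_pair: "fourier_pair p q \<Longrightarrow> ft (\<lambda>x. complex_of_real (p x)) \<xi> = complex_of_real (q (- \<xi>))"
  by (simp add: fourier_pair_def ft_def flip: inner_minus_left)

lemma Trap_minus: "Trap r (- \<xi>) = Trap r \<xi>"
  by (simp add: Trap_def trapezoid_def tent_def)

lemma ft_VP: "r > 0 \<Longrightarrow> ft (\<lambda>x. complex_of_real (VP r x)) \<xi> = complex_of_real (Trap r \<xi>)"
  using ft_fourier_pair[OF fourier_pair_VP] by (simp add: Trap_minus)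

lemma integrable_VP: "r > 0 \<Longrightarrow> integrable lborel (\<lambda>x. complex_of_real (VP r x))"
  by (intro integrable_of_real fourier_pair_integrable[OF fourier_pair_VP])

lemma ft_modulate: "ft (\<lambda>x. cis (\<eta> \<bullet> x) * w x) \<xi> = ft w (\<xi> - \<eta>)"
  unfolding ft_def by (simp add: cis_mult inner_diff_left flip: mult.assoc)

lemma complex_integrable_cis_minus_mult:
  "integrable lborel p \<Longrightarrow> integrable lborel (\<lambda>x. cis (- (\<xi> \<bullet> x)) * p x)"
  using complex_integrable_cis_mult[of p "- \<xi>"] unfolding inner_minus_left .

lemma borel_measurable_Tent [measurable]: "Tent r \<in> borel_measurable borel"
  unfolding Tent_def[abs_def] by measurable

lemma Fejer_modulated_eq:
  fixes \<eta> :: "'a::euclidean_space"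
  assumes "r > 0"
  shows "(LINT \<xi>|lborel. cis (\<xi> \<bullet> x) * complex_of_real (Tent r (\<xi> - \<eta>))) = cis (\<eta> \<bullet> x) * complex_of_real (Fejer r x)"
proof -
  have "(LINT \<xi>|lborel. cis (\<xi> \<bullet> x) * complex_of_real (Tent r (\<xi> - \<eta>)))
      = (LINT \<xi>|lborel. (\<lambda>\<zeta>. cis (\<eta> \<bullet> x) * (cis (x \<bullet> \<zeta>) * complex_of_real (Tent r \<zeta>))) (\<xi> - \<eta>))"
    by (intro Bochner_Integration.integral_cong refl)
       (simp add: cis_mult inner_diff_right inner_commute[of x] flip: mult.assoc)
  also have "\<dots> = (LINT \<zeta>|lborel. cis (\<eta> \<bullet> x) * (cis (x \<bullet> \<zeta>) * complex_of_real (Tent r \<zeta>)))"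
    by (rule integral_lborel_shift) measurable
  also have "\<dots> = cis (\<eta> \<bullet> x) * complex_of_real (Fejer r x)"
    using fourier_pair_Tent[OF assms, where 'a='a] by (simp add: fourier_pair_def)
  finally show ?thesis .
qed

lemma norm_ft_le: "integrable lborel u \<Longrightarrow> norm (ft u \<xi>) \<le> (LINT x|lborel. norm (u x))"
  unfolding ft_def by (rule order_trans[OF integral_norm_bound]) (simp add: norm_mult)

lemma continuous_on_ft:
  fixes u :: "'a::euclidean_space \<Rightarrow> complex"
  assumes u: "integrable lborel u"
  shows "continuous_on UNIV (ft u)"
proof (rule continuous_at_imp_continuous_on, rule ballI)
  fix \<xi> :: 'a
  have [measurable]: "u \<in> borel_measurable borel" using u by auto
  have c: "isCont cis t" for t
    using continuous_on_cis[OF continuous_on_id, of UNIV] by (simp add: continuous_on_eq_continuous_at)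
  have "(\<lambda>n. ft u (s n)) \<longlonglongrightarrow> ft u \<xi>" if s: "s \<longlonglongrightarrow> \<xi>" for s
    unfolding ft_def
  proof (rule integral_dominated_convergence[where w="\<lambda>x. norm (u x)"])
    show "AE x in lborel. (\<lambda>n. cis (- (s n \<bullet> x)) * u x) \<longlonglongrightarrow> cis (- (\<xi> \<bullet> x)) * u x"
      by (intro AE_I2 tendsto_mult tendsto_const isCont_tendsto_compose[OF c] tendsto_minus tendsto_inner s)
    show "AE x in lborel. norm (cis (- (s n \<bullet> x)) * u x) \<le> norm (u x)" for n
      by (simp add: norm_mult)
    show "integrable lborel (\<lambda>x. norm (u x))"
      by (rule integrable_norm[OF u])
  qed measurable
  then show "isCont (ft u) \<xi>"
    by (simp add: continuous_at_sequentially o_def)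
qed

lemma borel_measurable_ft [measurable]: "integrable lborel u \<Longrightarrow> ft u \<in> borel_measurable borel"
  by (rule borel_measurable_continuous_onI[OF continuous_on_ft])

lemma norm_integral_mult_le:
  fixes f u :: "'a \<Rightarrow> complex"
  assumes u: "integrable M u" and f: "f \<in> borel_measurable M" and C: "\<And>x. norm (f x) \<le> C"
  shows "norm (LINT x|M. f x * u x) \<le> C * (LINT x|M. norm (u x))"
proof -
  have "norm (LINT x|M. f x * u x) \<le> (LINT x|M. norm (f x * u x))"
    by (rule integral_norm_bound)
  also have "\<dots> \<le> (LINT x|M. C * norm (u x))"
  proof (rule integral_mono)
    show "integrable M (\<lambda>x. norm (f x * u x))"
      by (rule integrable_norm[OF integrable_bounded_mult[OF assms]])
    show "integrable M (\<lambda>x. C * norm (u x))"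
      using u by simp
    show "norm (f x * u x) \<le> C * norm (u x)" for x
      unfolding norm_mult by (rule mult_right_mono[OF C norm_ge_zero])
  qed
  finally show ?thesis by simp
qed

lemma conv_shift: "conv u (\<lambda>x. w (x - y)) x = conv u w (x - y)"
  unfolding conv_def by (simp only: diff_diff_eq add.commute[of y])

text \<open>A contraction argument in place of Wiener's local inversion: on the support of the tent \<open>\<tau>\<close>,
  the transform of \<open>U\<close> is \<open>ft g \<eta> - ft g\<close>, so convolving \<open>U\<close> with \<open>k\<close> gives \<open>ft g \<eta> * k - conv g k\<close>.
  As \<open>f\<close> annihilates all translates of \<open>conv g k\<close>, the correlation \<open>A\<close> of \<open>f\<close> and \<open>k\<close> is at most half
  of its own supremum.\<close>

lemma annihilates_modulated_Fejer:
  fixes f g :: "'a::euclidean_space \<Rightarrow> complex"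
  assumes fm [measurable]: "f \<in> borel_measurable borel" and fb: "\<And>x. norm (f x) \<le> C"
    and g: "integrable lborel g" and ann: "\<And>y. (LINT x|lborel. f x * g (x - y)) = 0"
    and r: "0 < r" "r \<le> \<epsilon>" and nz: "ft g \<eta> \<noteq> 0"
    and small: "(\<integral>\<^sup>+y. norm (g y) * shift_dist (\<lambda>x. complex_of_real (VP \<epsilon> x)) y \<partial>lborel) \<le> ennreal (norm (ft g \<eta>) / 2)"
  shows "(LINT x|lborel. f x * (cis (\<eta> \<bullet> x) * complex_of_real (Fejer r x))) = 0"
proof -
  have \<epsilon>: "\<epsilon> > 0" using r by simp
  have [measurable]: "g \<in> borel_measurable borel" using g by auto
  define V where "V = (\<lambda>x::'a. complex_of_real (VP \<epsilon> x))"
  define W where "W = (\<lambda>x. cis (\<eta> \<bullet> x) * V x)"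
  define U where "U = (\<lambda>x. ft g \<eta> * W x - conv g W x)"
  define k where "k = (\<lambda>x. cis (\<eta> \<bullet> x) * complex_of_real (Fejer r x))"
  define \<tau> where "\<tau> = (\<lambda>\<xi>. complex_of_real (Tent r (\<xi> - \<eta>)))"
  have V: "integrable lborel V" unfolding V_def by (rule integrable_VP[OF \<epsilon>])
  have W: "integrable lborel W" unfolding W_def by (rule complex_integrable_cis_mult[OF V])
  have gW: "integrable lborel (conv g W)" by (rule integrable_conv[OF g W])
  have cW: "integrable lborel (\<lambda>x. ft g \<eta> * W x)" using W by simp
  have U: "integrable lborel U" unfolding U_def by (intro Bochner_Integration.integrable_diff cW gW)
  have k: "integrable lborel k" unfolding k_def
    by (intro complex_integrable_cis_mult integrable_of_real integrable_Fejer r(1))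
  have \<tau>: "integrable lborel \<tau>" unfolding \<tau>_def
    using integrable_lborel_shift[OF fourier_pair_integrable[OF fourier_pair_Tent[OF r(1)]], of \<eta>] by simp
  have [measurable]: "U \<in> borel_measurable borel" "k \<in> borel_measurable borel" using U k by auto
  have k_eq: "k = (\<lambda>x. LINT \<xi>|lborel. cis (\<xi> \<bullet> x) * \<tau> \<xi>)"
    unfolding k_def \<tau>_def Fejer_modulated_eq[OF r(1)] ..
  have ftW: "ft W \<xi> = complex_of_real (Trap \<epsilon> (\<xi> - \<eta>))" for \<xi>
    unfolding W_def ft_modulate unfolding V_def by (rule ft_VP[OF \<epsilon>])
  have ftU: "ft U \<xi> = (ft g \<eta> - ft g \<xi>) * ft W \<xi>" for \<xi>
  proof -
    have e: "cis (- (\<xi> \<bullet> x)) * U x = ft g \<eta> * (cis (- (\<xi> \<bullet> x)) * W x) - cis (- (\<xi> \<bullet> x)) * conv g W x" for x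
      unfolding U_def by (simp only: right_diff_distrib mult.left_commute)
    have "ft U \<xi> = (LINT x|lborel. ft g \<eta> * (cis (- (\<xi> \<bullet> x)) * W x)) - (LINT x|lborel. cis (- (\<xi> \<bullet> x)) * conv g W x)"
      unfolding ft_def[of U] e
      by (intro Bochner_Integration.integral_diff integrable_mult_right complex_integrable_cis_minus_mult W gW)
    also have "\<dots> = ft g \<eta> * ft W \<xi> - ft (conv g W) \<xi>"
      by (simp add: ft_def)
    finally show ?thesis by (simp add: ft_conv[OF g W] left_diff_distrib)
  qed
  have \<tau>U: "\<tau> \<xi> * ft U \<xi> = ft g \<eta> * \<tau> \<xi> - \<tau> \<xi> * ft g \<xi>" for \<xi>
  proof (cases "\<tau> \<xi> = 0")
    case False
    \<comment> \<open>Where the shifted tent is nonzero, each coordinate of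
      \<open>\<xi> - \<eta>\<close> is below \<open>r \<le> \<epsilon>\<close> in absolute value,
      hence in the flat part of the trapezoid, and \<open>ft W \<xi>\<close> equals one.\<close>
    then have "\<bar>(\<xi> - \<eta>) \<bullet> b\<bar> \<le> \<epsilon>" if "b \<in> Basis" for b
      using Tent_eq_0[OF r(1) that, of "\<xi> - \<eta>"] r(2) unfolding \<tau>_def by fastforce
    then have "ft W \<xi> = 1" unfolding ftW using Trap_eq_1[OF \<epsilon>, of "\<xi> - \<eta>"] by simp
    then show ?thesis by (simp add: ftU algebra_simps)
  qed simp
  have \<tau>g: "integrable lborel (\<lambda>\<xi>. \<tau> \<xi> * ft g \<xi>)"
  proof -
    have "integrable lborel (\<lambda>\<xi>. ft g \<xi> * \<tau> \<xi>)"
      by (rule integrable_bounded_mult[OF \<tau> _ norm_ft_le[OF g]]) (simp add: borel_measurable_ft[OF g])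
    then show ?thesis by (simp only: mult.commute)
  qed
  have conv_Uk: "conv U k x = ft g \<eta> * k x - conv g k x" for x
  proof -
    have i: "integrable lborel (\<lambda>\<xi>. ft g \<eta> * (cis (\<xi> \<bullet> x) * \<tau> \<xi>))"
      by (intro integrable_mult_right, rule integrable_bounded_mult[OF \<tau>, where C=1]) auto
    have i': "integrable lborel (\<lambda>\<xi>. cis (\<xi> \<bullet> x) * (\<tau> \<xi> * ft g \<xi>))"
      by (rule integrable_bounded_mult[OF \<tau>g, where C=1]) auto
    have "conv U k x = (LINT \<xi>|lborel. cis (\<xi> \<bullet> x) * (\<tau> \<xi> * ft U \<xi>))"
      using conv_inverse_ft[OF U \<tau>, of x] by (simp only: k_eq)
    also have "\<dots> = (LINT \<xi>|lborel. ft g \<eta> * (cis (\<xi> \<bullet> x) * \<tau> \<xi>) - cis (\<xi> \<bullet> x) * (\<tau> \<xi> * ft g \<xi>))"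
      by (simp only: \<tau>U right_diff_distrib mult.left_commute)
    also have "\<dots> = (LINT \<xi>|lborel. ft g \<eta> * (cis (\<xi> \<bullet> x) * \<tau> \<xi>)) - (LINT \<xi>|lborel. cis (\<xi> \<bullet> x) * (\<tau> \<xi> * ft g \<xi>))"
      by (rule Bochner_Integration.integral_diff[OF i i'])
    also have "\<dots> = ft g \<eta> * k x - conv g k x"
      using conv_inverse_ft[OF g \<tau>, of x] by (simp only: k_eq integral_mult_right_zero)
    finally show ?thesis .
  qed
  define A where "A = (\<lambda>y. LINT x|lborel. f x * k (x - y))"
  have [measurable]: "A \<in> borel_measurable borel" unfolding A_def by measurable
  have A_bound: "norm (A y) \<le> C * (LINT x|lborel. norm (k x))" for y
  proof -
    have "norm (A y) \<le> C * (LINT x|lborel. norm (k (x - y)))"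
      unfolding A_def by (rule norm_integral_mult_le[OF integrable_lborel_shift[OF k] _ fb]) simp
    also have "\<dots> = C * (LINT x|lborel. norm (k x))"
      using integral_lborel_shift[of "\<lambda>x. norm (k x)" y] by simp
    finally show ?thesis .
  qed
  \<comment> \<open>Pair \<open>f\<close> with the translate by \<open>y\<close> of
    \<open>conv U k\<close>. By Fubini this is an average of \<open>A\<close> with weight
    \<open>U\<close>; by \<open>conv_Uk\<close> it is \<open>ft g \<eta> * A y\<close> minus a
    pairing with \<open>conv g k\<close>, which vanishes because that convolution superposes
    translates of \<open>g\<close>.\<close>
  have A_eq: "ft g \<eta> * A y = (LINT z|lborel. U z * A (y + z))" for y
  proof -
    have "(LINT x|lborel. f x * conv U k (x - y)) = (LINT z|lborel. U z * A (y + z))"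
      using integral_mult_conv[OF U integrable_lborel_shift[OF k, of y] fm fb]
      unfolding conv_shift[of U k] A_def by (simp only: diff_diff_eq add.commute)
    moreover have "(LINT x|lborel. f x * conv g k (x - y)) = 0"
    proof -
      have "(LINT x|lborel. f x * conv k g (x - y)) = (LINT z|lborel. k z * (LINT x|lborel. f x * g (x - (y + z))))"
        using integral_mult_conv[OF k integrable_lborel_shift[OF g, of y] fm fb]
        unfolding conv_shift[of k g] by (simp only: diff_diff_eq add.commute)
      then show ?thesis
        unfolding conv_commute[OF \<open>g \<in> borel_measurable borel\<close> \<open>k \<in> borel_measurable borel\<close>] by (simp add: ann)
    qed
    moreover have "(LINT x|lborel. f x * conv U k (x - y)) = ft g \<eta> * A y - (LINT x|lborel. f x * conv g k (x - y))"
    proof -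
      have "integrable lborel (\<lambda>x. f x * k (x - y))"
        by (rule integrable_bounded_mult[OF integrable_lborel_shift[OF k] _ fb]) simp
      moreover have "integrable lborel (\<lambda>x. f x * conv g k (x - y))"
        by (rule integrable_bounded_mult[OF integrable_lborel_shift[OF integrable_conv[OF g k]] _ fb]) simp
      ultimately have "(LINT x|lborel. ft g \<eta> * (f x * k (x - y)) - f x * conv g k (x - y))
          = ft g \<eta> * A y - (LINT x|lborel. f x * conv g k (x - y))"
        unfolding A_def integral_mult_right_zero[symmetric]
        by (intro Bochner_Integration.integral_diff integrable_mult_right)
      then show ?thesis
        unfolding conv_Uk by (simp only: right_diff_distrib mult.left_commute)
    qed
    ultimately show ?thesis by simp
  qed
  have normU: "(LINT x|lborel. norm (U x)) \<le> norm (ft g \<eta>) / 2"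
  proof -
    have "ennreal (LINT x|lborel. norm (U x)) = (\<integral>\<^sup>+x. norm (U x) \<partial>lborel)"
      using U by (intro nn_integral_eq_integral[symmetric]) simp_all
    moreover have "(\<integral>\<^sup>+x. norm (U x) \<partial>lborel) \<le> (\<integral>\<^sup>+y. norm (g y) * shift_dist V y \<partial>lborel)"
      unfolding U_def W_def by (rule conv_modulation_approx[OF g V])
    moreover note small[folded V_def]
    ultimately have "ennreal (LINT x|lborel. norm (U x)) \<le> ennreal (norm (ft g \<eta>) / 2)"
      by simp
    then show ?thesis by (subst (asm) ennreal_le_iff) simp_all
  qed
  define S where "S = (SUP y. norm (A y))"
  \<comment> \<open>Finiteness of \<open>S\<close> comes from \<open>f\<close> being bounded and
    \<open>k\<close> integrable; it is what turns \<open>S \<le> S / 2\<close> into a contradiction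
    with \<open>S > 0\<close>.\<close>
  have bdd: "bdd_above (range (\<lambda>y. norm (A y)))"
    using A_bound by (intro bdd_aboveI2)
  have AS: "norm (A y) \<le> S" for y
    unfolding S_def by (rule cSUP_upper[OF UNIV_I bdd])
  have "norm (A y) \<le> S / 2" for y
  proof -
    have "norm (ft g \<eta>) * norm (A y) \<le> S * (LINT z|lborel. norm (U z))"
      unfolding norm_mult[symmetric] A_eq mult.commute[of "U _"]
      by (rule norm_integral_mult_le[OF U _ AS]) measurable
    also have "\<dots> \<le> S * (norm (ft g \<eta>) / 2)"
      by (rule mult_left_mono[OF normU order_trans[OF norm_ge_zero AS]])
    finally show ?thesis using nz by (simp add: mult.commute)
  qed
  then have "(SUP y. norm (A y)) \<le> S / 2"
    by (intro cSUP_least) simp_all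
  then have "S \<le> S / 2" unfolding S_def[symmetric] .
  moreover have "0 \<le> S" using order_trans[OF norm_ge_zero AS] .
  ultimately have "norm (A 0) \<le> 0" using AS[of 0] by linarith
  then show ?thesis by (simp add: A_def k_def)
qed

text \<open>The dilation taking \<open>VP 1\<close> to \<open>VP r\<close> preserves the L^1 norm
  and turns a shift by \<open>y\<close> into one by \<open>r *\<^sub>R y\<close>. Thus a wide kernel
  barely notices a fixed shift.\<close>

lemma shift_dist_VP:
  fixes y :: "'a::euclidean_space"
  assumes "r > 0"
  shows "shift_dist (\<lambda>x. complex_of_real (VP r x)) y = shift_dist (\<lambda>x. complex_of_real (VP 1 x)) (r *\<^sub>R y)"
proof -
  let ?F = "\<lambda>x. ennreal (norm (complex_of_real (VP 1 (x - r *\<^sub>R y)) - complex_of_real (VP 1 x)))"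
  have "ennreal (norm (complex_of_real (VP r (x - y)) - complex_of_real (VP r x))) = ennreal (r ^ DIM('a)) * ?F (r *\<^sub>R x)" for x
  proof -
    have "norm (complex_of_real (VP r (x - y)) - complex_of_real (VP r x))
        = r ^ DIM('a) * norm (complex_of_real (VP 1 (r *\<^sub>R x - r *\<^sub>R y)) - complex_of_real (VP 1 (r *\<^sub>R x)))"
      using assms unfolding VP_scale[of r "x - y"] VP_scale[of r x]
      by (simp add: scaleR_diff_right abs_mult flip: of_real_diff of_real_power of_real_mult right_diff_distrib)
    then show ?thesis
      using assms by (simp only: ennreal_mult zero_le_power less_imp_le norm_ge_zero)
  qed
  moreover have "(\<integral>\<^sup>+x. ?F x \<partial>lborel) = (\<integral>\<^sup>+x. ennreal (r ^ DIM('a)) * ?F (r *\<^sub>R x) \<partial>lborel)"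
    by (rule nn_integral_lborel_scale[OF _ assms]) measurable
  ultimately show ?thesis
    unfolding shift_dist_def by simp
qed

lemma weighted_shift_dist_VP_tendsto_0:
  fixes u :: "'a::euclidean_space \<Rightarrow> complex"
  assumes u: "integrable lborel u"
  shows "(\<lambda>n. \<integral>\<^sup>+y. norm (u y) * shift_dist (\<lambda>x. complex_of_real (VP (1 / real (Suc n)) x)) y \<partial>lborel) \<longlonglongrightarrow> 0"
proof -
  have "(\<lambda>n. \<integral>\<^sup>+y. norm (u y) * shift_dist (\<lambda>x. complex_of_real (VP 1 x)) ((1 / real (Suc n)) *\<^sub>R y) \<partial>lborel) \<longlonglongrightarrow> 0"
    by (rule weighted_shift_dist_tendsto_0[OF u integrable_VP])
       (auto intro!: continuous_of_real isCont_VP LIMSEQ_Suc[OF lim_inverse_n', simplified])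
  then show ?thesis
    by (subst shift_dist_VP) simp_all
qed

text \<open>On the compact set \<open>K\<close> the continuous function
  \<open>norm (ft g \<eta>)\<close> has a positive minimum. The smallness condition does not depend
  on \<open>\<eta>\<close> on its left side, so meeting it at the minimum meets it on all of
  \<open>K\<close>.\<close>

lemma annihilates_modulated_Fejer_compact:
  fixes f g :: "'a::euclidean_space \<Rightarrow> complex"
  assumes fm: "f \<in> borel_measurable borel" and fb: "\<And>x. norm (f x) \<le> C"
    and g: "integrable lborel g" and ann: "\<And>y. (LINT x|lborel. f x * g (x - y)) = 0"
    and K: "compact K" and nz: "\<And>\<eta>. \<eta> \<in> K \<Longrightarrow> ft g \<eta> \<noteq> 0"
  shows "\<exists>r0>0. \<forall>r \<eta>. 0 < r \<and> r \<le> r0 \<and> \<eta> \<in> K \<longrightarrow>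
     (LINT x|lborel. f x * (cis (\<eta> \<bullet> x) * complex_of_real (Fejer r x))) = 0"
proof (cases "K = {}")
  case True
  then show ?thesis by (intro exI[of _ 1]) simp
next
  case False
  have "continuous_on K (\<lambda>\<eta>. norm (ft g \<eta>))"
    using continuous_on_ft[OF g] by (intro continuous_on_norm) (rule continuous_on_subset, auto)
  from continuous_attains_inf[OF K False this]
  obtain \<eta>0 where \<eta>0: "\<eta>0 \<in> K" "\<And>\<eta>. \<eta> \<in> K \<Longrightarrow> norm (ft g \<eta>0) \<le> norm (ft g \<eta>)" by blast
  have "0 < ennreal (norm (ft g \<eta>0) / 2)" using nz[OF \<eta>0(1)] by simp
  from order_tendstoD(2)[OF weighted_shift_dist_VP_tendsto_0[OF g] this]
  obtain n where n: "(\<integral>\<^sup>+y. norm (g y) * shift_dist (\<lambda>x. complex_of_real (VP (1 / real (Suc n)) x)) y \<partial>lborel)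
      < ennreal (norm (ft g \<eta>0) / 2)"
    by (auto simp: eventually_sequentially)
  show ?thesis
  proof (intro exI[of _ "1 / real (Suc n)"] conjI allI impI)
    fix r \<eta> assume r: "0 < r \<and> r \<le> 1 / real (Suc n) \<and> \<eta> \<in> K"
    have "ennreal (norm (ft g \<eta>0) / 2) \<le> ennreal (norm (ft g \<eta>) / 2)"
      using \<eta>0(2) r by (intro ennreal_leI) simp
    from order.trans[OF less_imp_le[OF n] this] have s: "(\<integral>\<^sup>+y. norm (g y) * shift_dist (\<lambda>x. complex_of_real (VP (1 / real (Suc n)) x)) y \<partial>lborel)
      \<le> ennreal (norm (ft g \<eta>) / 2)" .
    show "(LINT x|lborel. f x * (cis (\<eta> \<bullet> x) * complex_of_real (Fejer r x))) = 0"
      using r by (intro annihilates_modulated_Fejer[OF fm fb g ann _ _ nz s]) auto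
  qed simp
qed

text \<open>A pairing is a convolution with the reflected function evaluated at 0, so this is
  \<open>conv_inverse_ft\<close> at that point.\<close>

lemma integral_mult_inverse_ft:
  fixes u \<tau> :: "'a::euclidean_space \<Rightarrow> complex"
  assumes u: "integrable lborel u" and \<tau>: "integrable lborel \<tau>"
  shows "(LINT x|lborel. u x * (LINT \<xi>|lborel. cis (\<xi> \<bullet> x) * \<tau> \<xi>)) =
     (LINT \<xi>|lborel. \<tau> \<xi> * (LINT x|lborel. u x * cis (\<xi> \<bullet> x)))"
proof -
  have [measurable]: "u \<in> borel_measurable borel" "\<tau> \<in> borel_measurable borel"
    using u \<tau> by auto
  define D where "D = (\<lambda>x. LINT \<xi>|lborel. cis (\<xi> \<bullet> x) * \<tau> \<xi>)"
  have [measurable]: "D \<in> borel_measurable borel"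
    unfolding D_def by measurable
  have u': "integrable lborel (\<lambda>y. u (0 - y))"
  proof -
    have "integrable (distr lborel borel (\<lambda>y. 0 - y)) u"
      using u by (simp only: lborel_distr_reflect)
    then show ?thesis by (subst (asm) integrable_distr_eq) auto
  qed
  have "(LINT x|lborel. u x * D x) = conv (\<lambda>y. u (0 - y)) D 0"
    unfolding conv_def by (rule integral_lborel_reflect[symmetric, of "\<lambda>x. u x * D x" 0]) measurable
  also have "\<dots> = (LINT \<xi>|lborel. \<tau> \<xi> * ft (\<lambda>y. u (0 - y)) \<xi>)"
    using conv_inverse_ft[OF u' \<tau>, of 0] by (simp add: D_def)
  also have "\<dots> = (LINT \<xi>|lborel. \<tau> \<xi> * (LINT x|lborel. u x * cis (\<xi> \<bullet> x)))"
  proof -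
    have "ft (\<lambda>y. u (0 - y)) \<xi> = (LINT x|lborel. u x * cis (\<xi> \<bullet> x))" for \<xi>
      using integral_lborel_reflect[of "\<lambda>x. u x * cis (\<xi> \<bullet> x)" 0]
      by (simp add: ft_def mult.commute)
    then show ?thesis by simp
  qed
  finally show ?thesis unfolding D_def .
qed

section \<open>Band-pass parts and functions of mean zero\<close>

lemma integrable_Trap:
  "r > 0 \<Longrightarrow> integrable lborel (\<lambda>\<xi>::'a::euclidean_space. complex_of_real (Trap r \<xi> / (2 * pi) ^ DIM('a)))"
  by (intro integrable_of_real integrable_divide fourier_pair_integrable[OF fourier_pair_Trap])

lemma conv_VP_eq:
  fixes h :: "'a::euclidean_space \<Rightarrow> complex"
  assumes h: "integrable lborel h" and r: "r > 0"
  shows "conv h (\<lambda>x. complex_of_real (VP r x)) x =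
    (LINT \<xi>|lborel. cis (\<xi> \<bullet> x) * (complex_of_real (Trap r \<xi> / (2 * pi) ^ DIM('a)) * ft h \<xi>))"
proof -
  have "complex_of_real (VP r x) = (LINT \<xi>|lborel. cis (\<xi> \<bullet> x) * complex_of_real (Trap r \<xi> / (2 * pi) ^ DIM('a)))" for x :: 'a
  proof -
    have "(LINT \<xi>|lborel. cis (x \<bullet> \<xi>) * complex_of_real (Trap r \<xi>)) / complex_of_real ((2 * pi) ^ DIM('a))
        = complex_of_real (VP r x)"
      using fourier_pair_Trap[OF r, where 'a='a] by (simp add: fourier_pair_def)
    then show ?thesis
      by (simp add: inner_commute)
  qed
  then have "(\<lambda>x::'a. complex_of_real (VP r x)) = (\<lambda>x. LINT \<xi>|lborel. cis (\<xi> \<bullet> x) * complex_of_real (Trap r \<xi> / (2 * pi) ^ DIM('a)))"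
    by (rule ext)
  then show ?thesis
    using conv_inverse_ft[OF h integrable_Trap[OF r], of x] by simp
qed

text \<open>Multiplying \<open>f\<close> by a wide Fejer kernel smears its spectrum only slightly, so the product still has
  no spectrum in the annulus; this replaces a partition of unity on the frequency side.\<close>

lemma annihilates_band_pass:
  fixes f h :: "'a::euclidean_space \<Rightarrow> complex"
  assumes fm [measurable]: "f \<in> borel_measurable borel" and fb: "\<And>x. norm (f x) \<le> C"
    and h: "integrable lborel h" and eR: "0 < e" "e \<le> R"
    and H: "\<And>B. \<exists>r0>0. \<forall>r \<eta>. 0 < r \<and> r \<le> r0 \<and> e \<le> norm \<eta> \<and> norm \<eta> \<le> B \<longrightarrow>
      (LINT x|lborel. f x * (cis (\<eta> \<bullet> x) * complex_of_real (Fejer r x))) = 0"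
  shows "(LINT x|lborel. f x * (conv h (\<lambda>x. complex_of_real (VP R x)) x - conv h (\<lambda>x. complex_of_real (VP e x)) x)) = 0"
proof -
  have R: "R > 0" using eR by simp
  define D where "D = (\<lambda>x. conv h (\<lambda>x. complex_of_real (VP R x)) x - conv h (\<lambda>x. complex_of_real (VP e x)) x)"
  define \<tau> where "\<tau> = (\<lambda>\<xi>. complex_of_real (Trap R \<xi> / (2 * pi) ^ DIM('a)) * ft h \<xi> - complex_of_real (Trap e \<xi> / (2 * pi) ^ DIM('a)) * ft h \<xi>)"
  have D: "integrable lborel D"
    unfolding D_def
    by (intro Bochner_Integration.integrable_diff integrable_conv h integrable_VP R eR)
  have [measurable]: "D \<in> borel_measurable borel" using D by auto
  have tr: "integrable lborel (\<lambda>\<xi>. complex_of_real (Trap r \<xi> / (2 * pi) ^ DIM('a)) * ft h \<xi>)" if "r > 0" for r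
  proof -
    have "integrable lborel (\<lambda>\<xi>. ft h \<xi> * complex_of_real (Trap r \<xi> / (2 * pi) ^ DIM('a)))"
      by (rule integrable_bounded_mult[OF integrable_Trap[OF that] _ norm_ft_le[OF h]])
         (simp add: borel_measurable_ft[OF h])
    then show ?thesis by (simp only: mult.commute)
  qed
  have \<tau>: "integrable lborel \<tau>"
    unfolding \<tau>_def by (intro Bochner_Integration.integrable_diff tr R eR)
  have D_eq: "D = (\<lambda>x. LINT \<xi>|lborel. cis (\<xi> \<bullet> x) * \<tau> \<xi>)"
  proof
    fix x
    have i: "integrable lborel (\<lambda>\<xi>. cis (\<xi> \<bullet> x) * (complex_of_real (Trap r \<xi> / (2 * pi) ^ DIM('a)) * ft h \<xi>))" if "r > 0" for r
      by (rule integrable_bounded_mult[OF tr[OF that], where C=1]) auto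
    show "D x = (LINT \<xi>|lborel. cis (\<xi> \<bullet> x) * \<tau> \<xi>)"
      unfolding D_def conv_VP_eq[OF h R] conv_VP_eq[OF h eR(1)] \<tau>_def right_diff_distrib
      by (rule Bochner_Integration.integral_diff[OF i[OF R] i[OF eR(1)], symmetric])
  qed
  \<comment> \<open>Below \<open>e\<close> both cut-offs equal one and cancel; if some coordinate
    exceeds \<open>2 * R\<close> both vanish. Summing the coordinates gives the outer radius at
    which \<open>H\<close> is invoked.\<close>
  have supp: "e \<le> norm \<xi> \<and> norm \<xi> \<le> real DIM('a) * (2 * R)" if nz: "\<tau> \<xi> \<noteq> 0" for \<xi>
  proof
    show "e \<le> norm \<xi>"
    proof (rule ccontr)
      assume "\<not> e \<le> norm \<xi>"
      then have b: "\<bar>\<xi> \<bullet> b\<bar> \<le> e" if "b \<in> Basis" for b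
        using Basis_le_norm[OF that, of \<xi>] by linarith
      then have "Trap e \<xi> = 1" by (intro Trap_eq_1 eR)
      moreover have "Trap R \<xi> = 1" using b eR(2) by (intro Trap_eq_1 R) (meson order_trans)
      ultimately show False using nz by (simp add: \<tau>_def)
    qed
    have b: "\<bar>\<xi> \<bullet> b\<bar> \<le> 2 * R" if "b \<in> Basis" for b
    proof (rule ccontr)
      assume "\<not> \<bar>\<xi> \<bullet> b\<bar> \<le> 2 * R"
      then have "Trap R \<xi> = 0" "Trap e \<xi> = 0"
        using eR by (auto intro!: Trap_eq_0[OF R that] Trap_eq_0[OF eR(1) that])
      then show False using nz by (simp add: \<tau>_def)
    qed
    have "norm \<xi> \<le> (\<Sum>b\<in>Basis. \<bar>\<xi> \<bullet> b\<bar>)" by (rule norm_le_l1)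
    also have "\<dots> \<le> (\<Sum>b\<in>(Basis::'a set). 2 * R)" by (rule sum_mono[OF b])
    finally show "norm \<xi> \<le> real DIM('a) * (2 * R)" by simp
  qed
  obtain r0 where r0: "r0 > 0" and van: "\<And>r \<eta>. 0 < r \<Longrightarrow> r \<le> r0 \<Longrightarrow> e \<le> norm \<eta> \<Longrightarrow> norm \<eta> \<le> real DIM('a) * (2 * R) \<Longrightarrow>
      (LINT x|lborel. f x * (cis (\<eta> \<bullet> x) * complex_of_real (Fejer r x))) = 0"
    using H[of "real DIM('a) * (2 * R)"] by blast
  \<comment> \<open>\<open>f\<close> is only bounded, but its product with a Fejer kernel is
    integrable, so the pairing can be moved to frequencies. There one of the two factors is always
    zero, by \<open>supp\<close> and \<open>van\<close>.\<close>
  have zero: "(LINT x|lborel. f x * (complex_of_real (Fejer r x) * D x)) = 0" if r: "0 < r" "r \<le> r0" for r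
  proof -
    let ?u = "\<lambda>x. f x * complex_of_real (Fejer r x)"
    have u: "integrable lborel ?u"
      by (rule integrable_bounded_mult[OF integrable_of_real[OF integrable_Fejer[OF r(1)]] _ fb]) measurable
    have "(LINT x|lborel. f x * (complex_of_real (Fejer r x) * D x)) = (LINT x|lborel. ?u x * D x)"
      by (simp only: mult.assoc)
    also have "\<dots> = (LINT \<xi>|lborel. \<tau> \<xi> * (LINT x|lborel. ?u x * cis (\<xi> \<bullet> x)))"
      unfolding D_eq by (rule integral_mult_inverse_ft[OF u \<tau>])
    also have "\<dots> = (LINT \<xi>|(lborel::'a measure). 0)"
    proof (rule Bochner_Integration.integral_cong[OF refl])
      fix \<xi>
      have e: "?u x * cis (\<xi> \<bullet> x) = f x * (cis (\<xi> \<bullet> x) * complex_of_real (Fejer r x))" for x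
        by (simp only: mult_ac)
      show "\<tau> \<xi> * (LINT x|lborel. ?u x * cis (\<xi> \<bullet> x)) = 0"
        unfolding e using van[OF r] supp[of \<xi>] by (cases "\<tau> \<xi> = 0") simp_all
    qed
    finally show ?thesis by simp
  qed
  let ?r = "\<lambda>n. r0 / real (Suc n)"
  have r: "0 < ?r n" "?r n \<le> r0" for n
    using r0 by (auto simp: field_simps)
  have rlim: "?r \<longlonglongrightarrow> 0"
    using LIMSEQ_Suc[OF lim_const_over_n[of r0]] by simp
  \<comment> \<open>Now the spatial cut-off is removed: the Fejer kernels tend to 1 and are bounded
    by 1, and \<open>D\<close> is integrable.\<close>
  have "(\<lambda>n. LINT x|lborel. f x * (complex_of_real (Fejer (?r n) x) * D x)) \<longlonglongrightarrow> (LINT x|lborel. f x * D x)"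
  proof (rule integral_dominated_convergence[where w="\<lambda>x. norm (f x * D x)"])
    show "integrable lborel (\<lambda>x. norm (f x * D x))"
      by (rule integrable_norm[OF integrable_bounded_mult[OF D _ fb]]) simp
    show "AE x in lborel. (\<lambda>n. f x * (complex_of_real (Fejer (?r n) x) * D x)) \<longlonglongrightarrow> f x * D x"
    proof (rule AE_I2)
      fix x
      have "(\<lambda>n. f x * (complex_of_real (Fejer (?r n) x) * D x)) \<longlonglongrightarrow> f x * (complex_of_real 1 * D x)"
        by (intro tendsto_mult tendsto_const tendsto_of_real tendsto_Fejer rlim)
      then show "(\<lambda>n. f x * (complex_of_real (Fejer (?r n) x) * D x)) \<longlonglongrightarrow> f x * D x" by simp
    qed
    show "AE x in lborel. norm (f x * (complex_of_real (Fejer (?r n) x) * D x)) \<le> norm (f x * D x)" for n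
    proof (rule AE_I2)
      fix x
      have "norm (f x) * (\<bar>Fejer (?r n) x\<bar> * norm (D x)) \<le> norm (f x) * norm (D x)"
        unfolding abs_of_nonneg[OF Fejer_nonneg]
        by (intro mult_left_mono mult_left_le_one_le Fejer_nonneg Fejer_le_1) simp_all
      then show "norm (f x * (complex_of_real (Fejer (?r n) x) * D x)) \<le> norm (f x * D x)"
        by (simp add: norm_mult)
    qed
  qed measurable
  then have "(\<lambda>n::nat. 0) \<longlonglongrightarrow> (LINT x|lborel. f x * D x)"
    unfolding zero[OF r] .
  then have "(LINT x|lborel. f x * D x) = 0"
    by (simp add: LIMSEQ_const_iff)
  then show ?thesis unfolding D_def .
qed

text \<open>The substitution by \<open>1 / r\<close> fixes the weight and moves \<open>r\<close>
  into the shift, which is the form required by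
  \<open>weighted_shift_dist_tendsto_0\<close>.\<close>

lemma weighted_shift_dist_VP_scale:
  fixes h :: "'a::euclidean_space \<Rightarrow> complex"
  assumes [measurable]: "h \<in> borel_measurable borel" and r: "r > 0"
  shows "(\<integral>\<^sup>+y. norm (complex_of_real (VP r y)) * shift_dist h y \<partial>lborel) =
    (\<integral>\<^sup>+y. norm (complex_of_real (VP 1 y)) * shift_dist h ((1 / r) *\<^sub>R y) \<partial>lborel)"
proof -
  have "(\<integral>\<^sup>+y. norm (complex_of_real (VP r y)) * shift_dist h y \<partial>lborel) =
    (\<integral>\<^sup>+y. ennreal ((1 / r) ^ DIM('a)) * (norm (complex_of_real (VP r ((1 / r) *\<^sub>R y))) * shift_dist h ((1 / r) *\<^sub>R y)) \<partial>lborel)"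
    by (rule nn_integral_lborel_scale) (use r in simp_all)
  also have "\<dots> = (\<integral>\<^sup>+y. norm (complex_of_real (VP 1 y)) * shift_dist h ((1 / r) *\<^sub>R y) \<partial>lborel)"
  proof (rule nn_integral_cong)
    fix y :: 'a
    have "ennreal ((1 / r) ^ DIM('a)) * ennreal (norm (complex_of_real (VP r ((1 / r) *\<^sub>R y))))
        = ennreal ((1 / r) ^ DIM('a) * norm (complex_of_real (VP r ((1 / r) *\<^sub>R y))))"
      using r by (intro ennreal_mult[symmetric]) auto
    also have "(1 / r) ^ DIM('a) * norm (complex_of_real (VP r ((1 / r) *\<^sub>R y))) = norm (complex_of_real (VP 1 y))"
      using r unfolding VP_scale[of r "(1 / r) *\<^sub>R y"] by (simp add: norm_mult norm_power power_divide)
    finally show "ennreal ((1 / r) ^ DIM('a)) * (norm (complex_of_real (VP r ((1 / r) *\<^sub>R y))) * shift_dist h ((1 / r) *\<^sub>R y))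
        = norm (complex_of_real (VP 1 y)) * shift_dist h ((1 / r) *\<^sub>R y)"
      by (simp only: mult.assoc[symmetric])
  qed
  finally show ?thesis .
qed

text \<open>Both errors are instances of \<open>conv_modulation_approx\<close> at frequency 0 with
  the roles exchanged. With the narrow kernel averaging \<open>h\<close>, the main term is
  \<open>h\<close> itself because the kernel has integral one; with \<open>h\<close> averaging the
  wide kernel, the main term vanishes because \<open>h\<close> has mean zero.\<close>

lemma annihilates_zero_mean:
  fixes f h :: "'a::euclidean_space \<Rightarrow> complex"
  assumes fm: "f \<in> borel_measurable borel" and fb: "\<And>x. norm (f x) \<le> C"
    and h: "integrable lborel h" and hc: "AE x in lborel. isCont h x" and h0: "(LINT x|lborel. h x) = 0"
    and H: "\<And>e B. e > 0 \<Longrightarrow> \<exists>r0>0. \<forall>r \<eta>. 0 < r \<and> r \<le> r0 \<and> e \<le> norm \<eta> \<and> norm \<eta> \<le> B \<longrightarrow>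
      (LINT x|lborel. f x * (cis (\<eta> \<bullet> x) * complex_of_real (Fejer r x))) = 0"
  shows "(LINT x|lborel. f x * h x) = 0"
proof -
  have C: "0 \<le> C" using fb order_trans[OF norm_ge_zero] by blast
  have hm: "h \<in> borel_measurable borel" using h by auto
  let ?V = "\<lambda>r x::'a. complex_of_real (VP r x)"
  let ?R = "\<lambda>n. real (Suc n)" and ?e = "\<lambda>n. 1 / real (Suc n)"
  have Vi: "integrable lborel (?V r)" if "r > 0" for r by (rule integrable_VP[OF that])
  have Vm: "?V r \<in> borel_measurable borel" for r by measurable
  have hV: "integrable lborel (conv h (?V r))" if "r > 0" for r by (rule integrable_conv[OF h Vi[OF that]])
  define a where "a = (\<lambda>n. \<integral>\<^sup>+y. norm (?V (?R n) y) * shift_dist h y \<partial>lborel)"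
  define b where "b = (\<lambda>n. \<integral>\<^sup>+y. norm (h y) * shift_dist (?V (?e n)) y \<partial>lborel)"
  have "a \<longlonglongrightarrow> 0"
  proof -
    have "(\<lambda>n. \<integral>\<^sup>+y. norm (?V 1 y) * shift_dist h ((1 / ?R n) *\<^sub>R y) \<partial>lborel) \<longlonglongrightarrow> 0"
      by (rule weighted_shift_dist_tendsto_0[OF Vi h hc])
         (auto intro!: LIMSEQ_Suc[OF lim_inverse_n', simplified])
    then show ?thesis
      unfolding a_def by (subst weighted_shift_dist_VP_scale[OF hm]) simp_all
  qed
  moreover have "b \<longlonglongrightarrow> 0"
    unfolding b_def by (rule weighted_shift_dist_VP_tendsto_0[OF h])
  ultimately have "(\<lambda>n. ennreal C * (a n + b n)) \<longlonglongrightarrow> ennreal C * (0 + 0)"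
    by (intro ennreal_tendsto_cmult tendsto_add) simp_all
  moreover have "ennreal (norm (LINT x|lborel. f x * h x)) \<le> ennreal C * (a n + b n)" for n
  proof -
    have pos: "0 < ?R n" "0 < ?e n" "?e n \<le> ?R n" by (auto simp: field_simps)
    \<comment> \<open>This is \<open>h\<close> minus its band-pass part. As \<open>f\<close>
      annihilates the band-pass part, \<open>h\<close> and \<open>?u\<close> have the same pairing
      with \<open>f\<close>.\<close>
    let ?u = "\<lambda>x. (h x - conv h (?V (?R n)) x) + conv h (?V (?e n)) x"
    have ui: "integrable lborel ?u"
      by (intro Bochner_Integration.integrable_add Bochner_Integration.integrable_diff h hV pos)
    have bp: "(LINT x|lborel. f x * (conv h (?V (?R n)) x - conv h (?V (?e n)) x)) = 0"
      by (rule annihilates_band_pass[OF fm fb h pos(2,3)]) (rule H[OF pos(2)])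
    have "integrable lborel (\<lambda>x. f x * h x)" "integrable lborel (\<lambda>x. f x * (conv h (?V (?R n)) x - conv h (?V (?e n)) x))"
      by (intro integrable_bounded_mult[OF _ _ fb] Bochner_Integration.integrable_diff h hV pos; use fm in simp)+
    then have "(LINT x|lborel. f x * h x - f x * (conv h (?V (?R n)) x - conv h (?V (?e n)) x)) = (LINT x|lborel. f x * h x)"
      using bp by simp
    moreover have "f x * h x - f x * (conv h (?V (?R n)) x - conv h (?V (?e n)) x) = f x * ?u x" for x
      by (simp add: algebra_simps)
    ultimately have "(LINT x|lborel. f x * h x) = (LINT x|lborel. f x * ?u x)"
      by simp
    then have "norm (LINT x|lborel. f x * h x) \<le> C * (LINT x|lborel. norm (?u x))"
      using norm_integral_mult_le[OF ui _ fb] fm by simp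
    then have "ennreal (norm (LINT x|lborel. f x * h x)) \<le> ennreal C * ennreal (LINT x|lborel. norm (?u x))"
      using C by (simp add: ennreal_leI flip: ennreal_mult)
    also have "\<dots> \<le> ennreal C * (a n + b n)"
    proof (rule mult_left_mono)
      have "ennreal (LINT x|lborel. norm (?u x)) = (\<integral>\<^sup>+x. norm (?u x) \<partial>lborel)"
        using ui by (intro nn_integral_eq_integral[symmetric]) simp_all
      also have "\<dots> \<le> (\<integral>\<^sup>+x. ennreal (norm (h x - conv h (?V (?R n)) x)) + ennreal (norm (conv h (?V (?e n)) x)) \<partial>lborel)"
        by (intro nn_integral_mono) (simp add: norm_triangle_ineq flip: ennreal_plus)
      also have "\<dots> = (\<integral>\<^sup>+x. norm (h x - conv h (?V (?R n)) x) \<partial>lborel) + (\<integral>\<^sup>+x. norm (conv h (?V (?e n)) x) \<partial>lborel)"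
        using hm hV[OF pos(1)] hV[OF pos(2)] by (intro nn_integral_add) auto
      also have "\<dots> \<le> a n + b n"
      proof (rule add_mono)
        have "(\<integral>\<^sup>+x. norm (ft (?V (?R n)) 0 * (cis (0 \<bullet> x) * h x) - conv (?V (?R n)) (\<lambda>x. cis (0 \<bullet> x) * h x) x) \<partial>lborel) \<le> a n"
          unfolding a_def by (rule conv_modulation_approx[OF Vi[OF pos(1)] h])
        moreover have "ft (?V (?R n)) 0 = 1"
          unfolding ft_VP[OF pos(1)] by (subst Trap_eq_1) simp_all
        ultimately show "(\<integral>\<^sup>+x. norm (h x - conv h (?V (?R n)) x) \<partial>lborel) \<le> a n"
          by (simp add: conv_commute[OF hm Vm])
        have "(\<integral>\<^sup>+x. norm (ft h 0 * (cis (0 \<bullet> x) * ?V (?e n) x) - conv h (\<lambda>x. cis (0 \<bullet> x) * ?V (?e n) x) x) \<partial>lborel) \<le> b n"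
          unfolding b_def by (rule conv_modulation_approx[OF h Vi[OF pos(2)]])
        moreover have "ft h 0 = 0" using h0 by (simp add: ft_def)
        ultimately show "(\<integral>\<^sup>+x. norm (conv h (?V (?e n)) x) \<partial>lborel) \<le> b n"
          by simp
      qed
      finally show "ennreal (LINT x|lborel. norm (?u x)) \<le> a n + b n" .
    qed simp
    finally show ?thesis .
  qed
  ultimately have "ennreal (norm (LINT x|lborel. f x * h x)) \<le> 0"
    by (intro LIMSEQ_le_const) auto
  then show ?thesis by simp
qed

section \<open>Bounded solutions are constant\<close>

lemma AE_isCont_indicator_cbox:
  "AE x in lborel. isCont (\<lambda>x. complex_of_real (indicator (cbox a b) x)) (x::'a::euclidean_space)"
proof -
  have "frontier (cbox a b) \<in> null_sets lborel"
    using negligible_convex_frontier[OF convex_box(1), of a b]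
    by (simp add: negligible_iff_null_sets null_sets_completion_iff)
  from AE_not_in[OF this] show ?thesis
  proof eventually_elim
    case (elim x)
    then have "isCont (indicator (cbox a b) :: 'a \<Rightarrow> real) x"
      by (simp add: isCont_indicator)
    then show ?case by (rule continuous_of_real)
  qed
qed

text \<open>The indicator of a box minus its volume times the indicator of the unit box has mean
  zero and is continuous off two null frontiers. So \<open>f\<close> has the same average
  \<open>c\<close> over every nondegenerate box, and shrinking cubes with corner at \<open>x\<close>
  recover \<open>f x\<close> for almost every \<open>x\<close>.\<close>

lemma AE_const_if_annihilates_zero_mean:
  fixes f :: "'a::euclidean_space \<Rightarrow> complex"
  assumes fm [measurable]: "f \<in> borel_measurable borel" and fb: "\<And>x. norm (f x) \<le> C"
    and ann: "\<And>h. integrable lborel h \<Longrightarrow> AE x in lborel. isCont h x \<Longrightarrow> (LINT x|lborel. h x) = 0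
      \<Longrightarrow> (LINT x|lborel. f x * h x) = 0"
  shows "\<exists>c. AE x in lborel. f x = c"
proof -
  let ?i = "\<lambda>a b x::'a. complex_of_real (indicator (cbox a b) x)"
  have i: "integrable lborel (?i a b)" for a b
    by (intro integrable_of_real integrable_real_indicator emeasure_lborel_cbox_finite) simp
  have fi: "integrable lborel (\<lambda>x. f x * ?i a b x)" for a b
    by (rule integrable_bounded_mult[OF i _ fb]) simp
  have si: "set_integrable lborel (cbox a b) f" for a b
    using fi[of a b] by (simp add: set_integrable_def scaleR_conv_of_real mult.commute)
  have LI: "(LINT x|lborel. f x * ?i a b x) = integral (cbox a b) f" for a b
    using set_borel_integral_eq_integral(2)[OF si[of a b]]
    by (simp add: set_lebesgue_integral_def scaleR_conv_of_real mult.commute)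
  define c where "c = integral (cbox 0 One) f"
  have box: "integral (cbox a b) f = complex_of_real (measure lborel (cbox a b)) * c" for a b
  proof -
    let ?h = "\<lambda>x. ?i a b x - complex_of_real (measure lborel (cbox a b)) * ?i 0 One x"
    have "(LINT x|lborel. f x * ?h x) = 0"
    proof (rule ann)
      show "integrable lborel ?h"
        by (intro Bochner_Integration.integrable_diff integrable_mult_right i)
      show "AE x in lborel. isCont ?h x"
        using AE_isCont_indicator_cbox[of a b] AE_isCont_indicator_cbox[of 0 "One::'a"]
        by eventually_elim (intro continuous_diff continuous_mult continuous_const)
      have "(LINT x|lborel. ?i a b x) = complex_of_real (measure lborel (cbox a b))" for a b
        by simp
      then show "(LINT x|lborel. ?h x) = 0"
        using i by simp
    qed
    moreover have "(LINT x|lborel. f x * ?h x) =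
        (LINT x|lborel. f x * ?i a b x) - complex_of_real (measure lborel (cbox a b)) * (LINT x|lborel. f x * ?i 0 One x)"
    proof -
      have e: "f x * ?h x = f x * ?i a b x - complex_of_real (measure lborel (cbox a b)) * (f x * ?i 0 One x)" for x
        by (simp only: right_diff_distrib mult.left_commute)
      show ?thesis
        unfolding e integral_mult_right_zero[symmetric]
        by (intro Bochner_Integration.integral_diff integrable_mult_right fi)
    qed
    ultimately show ?thesis by (simp add: LI c_def)
  qed
  have "f integrable_on cbox a b" for a b
    using set_borel_integral_eq_integral(1)[OF si] .
  from integrable_ccontinuous_explicit[OF this] obtain N where N: "negligible N"
    and lim: "\<And>x e. x \<notin> N \<Longrightarrow> 0 < e \<Longrightarrow>
       \<exists>d>0. \<forall>h. 0 < h \<and> h < d \<longrightarrow> norm (integral (cbox x (x + h *\<^sub>R One)) f /\<^sub>R h ^ DIM('a) - f x) < e"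
    by blast
  have eq: "f x = c" if x: "x \<notin> N" for x
  proof -
    have "norm (c - f x) < e" if e: "e > 0" for e
    proof -
      obtain d where d: "d > 0" "\<And>h. 0 < h \<Longrightarrow> h < d \<Longrightarrow> norm (integral (cbox x (x + h *\<^sub>R One)) f /\<^sub>R h ^ DIM('a) - f x) < e"
        using lim[OF x e] by blast
      define h where "h = d / 2"
      have h: "0 < h" "h < d" using d(1) by (auto simp: h_def)
      have "measure lborel (cbox x (x + h *\<^sub>R One)) = h ^ DIM('a)"
        using h(1) by (subst content_cbox) (auto simp: inner_add_left)
      then have "integral (cbox x (x + h *\<^sub>R One)) f /\<^sub>R h ^ DIM('a) = c"
        unfolding box using h(1) by (simp add: scaleR_conv_of_real field_simps)
      then show ?thesis using d(2)[OF h] by simp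
    qed
    then have "norm (c - f x) \<le> 0"
      by (meson not_le order_less_irrefl)
    then show ?thesis by simp
  qed
  have "AE x in lebesgue. x \<notin> N"
    using N by (intro AE_not_in) (simp add: negligible_iff_null_sets)
  then have "AE x in lebesgue. f x = c"
    by eventually_elim (rule eq)
  then show ?thesis
    by (auto simp: AE_completion_iff)
qed

section \<open>Borel representatives and the two implications\<close>

lemma lebesgue_AE_eq_borel:
  fixes f :: "'a::euclidean_space \<Rightarrow> complex"
  assumes f: "f \<in> borel_measurable lebesgue"
  obtains f' where "f' \<in> borel_measurable borel" "AE x in lebesgue. f x = f' x"
proof -
  obtain r where r: "r \<in> borel_measurable lborel" "AE x in lborel. Re (f x) = r x"
    using completion_ex_borel_measurable_real[of "\<lambda>x. Re (f x)" lborel] f by auto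
  obtain i where i: "i \<in> borel_measurable lborel" "AE x in lborel. Im (f x) = i x"
    using completion_ex_borel_measurable_real[of "\<lambda>x. Im (f x)" lborel] f by auto
  show thesis
  proof
    show "(\<lambda>x. Complex (r x) (i x)) \<in> borel_measurable borel"
      using r(1) i(1) by (simp add: borel_measurable_complex_iff)
    from r(2) i(2) have "AE x in lborel. f x = Complex (r x) (i x)"
      by eventually_elim (simp add: complex_eq_iff)
    then show "AE x in lebesgue. f x = Complex (r x) (i x)"
      by (rule AE_completion)
  qed
qed

lemma fourier_cong_AE:
  assumes "AE x in lebesgue. u x = v x" and "u \<in> borel_measurable lebesgue" "v \<in> borel_measurable lebesgue"
  shows "fourier u \<xi> = fourier v \<xi>"
proof -
  have m: "(\<lambda>x. cis (- (x \<bullet> \<xi>))) \<in> borel_measurable lebesgue"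
    by (rule measurable_completion) measurable
  have "(LINT x|lebesgue. cis (- (x \<bullet> \<xi>)) * u x) = (LINT x|lebesgue. cis (- (x \<bullet> \<xi>)) * v x)"
  proof (rule integral_cong_AE)
    show "AE x in lebesgue. cis (- (x \<bullet> \<xi>)) * u x = cis (- (x \<bullet> \<xi>)) * v x"
      using assms(1) by eventually_elim simp
  qed (use m assms in \<open>auto intro: borel_measurable_times\<close>)
  then show ?thesis by (simp add: fourier_def)
qed

text \<open>A multiplier commutes with translations: both transforms acquire the same factor
  \<open>cis (- (\<xi> \<bullet> y))\<close>. This upgrades the single relation for one bump to the
  annihilation of all translates of \<open>g\<close>.\<close>

lemma mult_op_L1_bump_translate:
  fixes g :: "'a::euclidean_space \<Rightarrow> complex"
  assumes g: "integrable lborel g" and eq: "\<And>\<xi>. fourier g \<xi> = m (- \<xi>) * fourier (bump \<delta> 0) \<xi>" and "\<delta> > 0"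
  shows "mult_op_L1 m (bump \<delta> y) (\<lambda>x. g (x - y))"
proof -
  have gy: "integrable lborel (\<lambda>x. g (x - y))" by (rule integrable_lborel_shift[OF g])
  have b0: "integrable lborel (bump \<delta> (0::'a))" by (rule integrable_bump[OF assms(3)])
  have bp: "integrable lborel (bump \<delta> y)" by (rule integrable_bump[OF assms(3)])
  have m: "u \<in> borel_measurable borel" if "integrable lborel u" for u :: "'a \<Rightarrow> complex" using that by auto
  have "bump \<delta> y = (\<lambda>x. bump \<delta> 0 (x - y))" by (rule ext) (rule bump_shift)
  then have 1: "fourier (bump \<delta> y) \<xi> = cis (- (\<xi> \<bullet> y)) * fourier (bump \<delta> 0) \<xi>" for \<xi>
    unfolding fourier_eq_ft[OF m[OF bp]] fourier_eq_ft[OF m[OF b0]]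
    using ft_shift[OF b0, of \<xi> y] by (simp add: ft_def)
  have 2: "fourier (\<lambda>x. g (x - y)) \<xi> = cis (- (\<xi> \<bullet> y)) * fourier g \<xi>" for \<xi>
    unfolding fourier_eq_ft[OF m[OF gy]] fourier_eq_ft[OF m[OF g]]
    using ft_shift[OF g, of \<xi> y] by (simp add: ft_def)
  have "integrable lebesgue (\<lambda>x. g (x - y))"
    using gy m[OF gy] by (simp add: integrable_completion)
  then show ?thesis
    unfolding mult_op_L1_def using 1 2 eq by (simp add: mult.left_commute)
qed

lemma solves_mD_imp_AE_const:
  fixes m :: "'a::euclidean_space \<Rightarrow> complex"
  assumes op: "\<forall>\<phi>. test_fun \<phi> \<longrightarrow> (\<exists>g. mult_op_L1 m \<phi> g)"
    and zeros: "{\<eta>. m \<eta> = 0} \<subseteq> {0}" and f: "Linfty f" "solves_mD m f"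
  shows "\<exists>c. AE x in lebesgue. f x = c"
proof -
  obtain f1 where f1 [measurable]: "f1 \<in> borel_measurable borel" and f1_eq: "AE x in lebesgue. f x = f1 x"
    using lebesgue_AE_eq_borel f(1) unfolding Linfty_def by blast
  obtain C where C: "AE x in lebesgue. norm (f x) \<le> C"
    using f(1) unfolding Linfty_def by blast
  \<comment> \<open>Truncation turns the almost everywhere bound into a bound at every point, as the
    preceding lemmas require, without changing \<open>f\<close> outside a null set.\<close>
  define f2 where "f2 = (\<lambda>x. if norm (f1 x) \<le> C then f1 x else 0)"
  have f2m [measurable]: "f2 \<in> borel_measurable borel" unfolding f2_def by measurable
  have f2b: "norm (f2 x) \<le> max C 0" for x by (simp add: f2_def le_max_iff_disj)
  have f2_eq: "AE x in lebesgue. f x = f2 x"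
    using f1_eq C by eventually_elim (simp add: f2_def)
  have "\<exists>r0>0. \<forall>r \<eta>. 0 < r \<and> r \<le> r0 \<and> e \<le> norm \<eta> \<and> norm \<eta> \<le> B \<longrightarrow>
      (LINT x|lborel. f2 x * (cis (\<eta> \<bullet> x) * complex_of_real (Fejer r x))) = 0" if e: "e > 0" for e B
  proof -
    \<comment> \<open>This gives \<open>\<delta> * norm \<eta> \<le> 1\<close> for every
      \<open>\<eta>\<close> of norm at most \<open>B\<close>, so the bump has no spectral zero in
      the annulus; the absolute value keeps \<open>\<delta>\<close> positive for arbitrary
      \<open>B\<close>.\<close>
    define \<delta> where "\<delta> = 1 / (\<bar>B\<bar> + 1)"
    have \<delta>: "\<delta> > 0" by (simp add: \<delta>_def)
    obtain g0 where g0: "mult_op_L1 m (bump \<delta> (0::'a)) g0"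
      using op test_fun_bump[OF \<delta>] by blast
    then have g0i: "integrable lebesgue g0" by (simp add: mult_op_L1_def)
    \<comment> \<open>\<open>g0\<close> is only Lebesgue measurable. A Borel representative has the
      same transform and can be handled over \<open>lborel\<close>.\<close>
    obtain g where g [measurable]: "g \<in> borel_measurable borel" and g_eq: "AE x in lebesgue. g0 x = g x"
      using lebesgue_AE_eq_borel borel_measurable_integrable[OF g0i] by blast
    have gm: "g \<in> borel_measurable lebesgue" by (rule measurable_completion) (simp add: g)
    have "integrable lebesgue g"
      using integrable_cong_AE_imp[OF g0i gm] g_eq by (simp add: eq_commute)
    then have gi: "integrable lborel g" by (simp add: integrable_completion)
    have fg: "fourier g \<xi> = m (- \<xi>) * fourier (bump \<delta> 0) \<xi>" for \<xi>
      using fourier_cong_AE[OF g_eq borel_measurable_integrable[OF g0i] gm, of \<xi>] g0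
      by (simp add: mult_op_L1_def)
    have ann: "(LINT x|lborel. f2 x * g (x - y)) = 0" for y
    proof -
      have "(LINT x|lebesgue. f x * g (x - y)) = 0"
        using f(2) test_fun_bump[OF \<delta>, of y] mult_op_L1_bump_translate[OF gi fg \<delta>, of y]
        unfolding solves_mD_def by blast
      moreover have "(LINT x|lebesgue. f x * g (x - y)) = (LINT x|lebesgue. f2 x * g (x - y))"
      proof (rule integral_cong_AE)
        have "(\<lambda>x. g (x - y)) \<in> borel_measurable lebesgue"
          by (rule measurable_completion) measurable
        then show "(\<lambda>x. f x * g (x - y)) \<in> borel_measurable lebesgue"
          using f(1) unfolding Linfty_def by (intro borel_measurable_times) auto
        show "(\<lambda>x. f2 x * g (x - y)) \<in> borel_measurable lebesgue"
          by (rule measurable_completion) measurable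
        show "AE x in lebesgue. f x * g (x - y) = f2 x * g (x - y)"
          using f2_eq by eventually_elim simp
      qed
      moreover have "(LINT x|lebesgue. f2 x * g (x - y)) = (LINT x|lborel. f2 x * g (x - y))"
        by (rule integral_completion) measurable
      ultimately show ?thesis by simp
    qed
    let ?K = "{\<eta>::'a. e \<le> norm \<eta> \<and> norm \<eta> \<le> B}"
    have "compact ?K"
    proof -
      have "?K = cball 0 B - ball 0 e" by (auto simp: dist_norm)
      then show ?thesis by (simp add: compact_diff)
    qed
    moreover have "ft g \<eta> \<noteq> 0" if \<eta>: "\<eta> \<in> ?K" for \<eta>
    proof -
      have "m (- \<eta>) \<noteq> 0" using zeros \<eta> e by force
      moreover have "ft (bump \<delta> 0) \<eta> \<noteq> 0"
      proof (rule ft_bump_nonzero[OF \<delta>])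
        have "norm \<eta> \<le> \<bar>B\<bar> + 1" using \<eta> by auto
        then show "\<delta> * norm \<eta> \<le> 1" by (simp add: \<delta>_def)
      qed
      moreover have "ft g \<eta> = m (- \<eta>) * ft (bump \<delta> 0) \<eta>"
        using fg[of \<eta>] unfolding fourier_eq_ft[OF g] fourier_eq_ft[OF borel_measurable_integrable[OF integrable_bump[OF \<delta>], simplified]]
        by simp
      ultimately show ?thesis by simp
    qed
    ultimately show ?thesis
      using annihilates_modulated_Fejer_compact[OF f2m f2b gi ann, of ?K] by simp
  qed
  then have "(LINT x|lborel. f2 x * h x) = 0"
    if "integrable lborel h" "AE x in lborel. isCont h x" "(LINT x|lborel. h x) = 0" for h
    by (rule annihilates_zero_mean[OF f2m f2b that])
  from AE_const_if_annihilates_zero_mean[OF f2m f2b this]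
  obtain c where "AE x in lborel. f2 x = c" by blast
  then have "AE x in lebesgue. f2 x = c" by (rule AE_completion)
  with f2_eq have "AE x in lebesgue. f x = c" by eventually_elim simp
  then show ?thesis by blast
qed

text \<open>Up to a nonzero constant, pairing with the character evaluates \<open>fourier g\<close>
  at \<open>- \<eta>\<close>, where the multiplier contributes the factor
  \<open>m \<eta>\<close>.\<close>

lemma character_solves_mD:
  assumes "m \<eta> = 0"
  shows "solves_mD m (\<lambda>x. cis (\<eta> \<bullet> x))"
  unfolding solves_mD_def
proof (intro allI impI)
  fix \<phi> g assume "test_fun \<phi> \<and> mult_op_L1 m \<phi> g"
  then have "fourier g (- \<eta>) = 0"
    using assms by (simp add: mult_op_L1_def)
  then show "(LINT x|lebesgue. cis (\<eta> \<bullet> x) * g x) = 0"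
    by (simp add: fourier_def inner_commute)
qed

text \<open>By continuity the character differs from \<open>c\<close> on an open set; being null,
  that set is empty, so the character is constant everywhere.\<close>

lemma character_not_AE_const:
  fixes \<eta> :: "'a::euclidean_space"
  assumes "AE x in lebesgue. cis (\<eta> \<bullet> x) = c"
  shows "\<eta> = 0"
proof (rule ccontr)
  assume \<eta>: "\<eta> \<noteq> 0"
  let ?S = "{x. cis (\<eta> \<bullet> x) \<noteq> c}"
  have S: "open ?S"
    by (intro open_Collect_neq continuous_intros)
  have "?S \<in> null_sets lebesgue"
    using assms by (subst AE_iff_null_sets) (simp_all add: S borel_open)
  then have "?S = {}"
    using open_not_negligible[OF S] by (auto simp: negligible_iff_null_sets)
  then have "cis (\<eta> \<bullet> x) = c" for x by blast
  \<comment> \<open>At 0 the character equals 1; at the second point the phase is \<open>pi\<close>,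
    so it equals -1.\<close>
  from this[of 0] this[of "(pi / (\<eta> \<bullet> \<eta>)) *\<^sub>R \<eta>"] show False
    using \<eta> by simp
qed

theorem theorem1p4:
  fixes m :: "'a::euclidean_space \<Rightarrow> complex"
  assumes "continuous_on UNIV m"
    and "\<forall>\<phi>. test_fun \<phi> \<longrightarrow> (\<exists>g. mult_op_L1 m \<phi> g)"
  shows "(\<forall>f. Linfty f \<and> solves_mD m f \<longrightarrow> (\<exists>c. AE x in lebesgue. f x = c))
           \<longleftrightarrow> {\<eta>. m \<eta> = 0} \<subseteq> {0}"
proof
  assume const: "\<forall>f. Linfty f \<and> solves_mD m f \<longrightarrow> (\<exists>c. AE x in lebesgue. f x = c)"
  show "{\<eta>. m \<eta> = 0} \<subseteq> {0}"
  proof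
    fix \<eta> assume "\<eta> \<in> {\<eta>. m \<eta> = 0}"
    then have "solves_mD m (\<lambda>x. cis (\<eta> \<bullet> x))"
      by (simp add: character_solves_mD)
    moreover have "Linfty (\<lambda>x. cis (\<eta> \<bullet> x))"
      unfolding Linfty_def
    proof
      show "(\<lambda>x. cis (\<eta> \<bullet> x)) \<in> borel_measurable lebesgue"
        by (rule measurable_completion) measurable
      show "\<exists>C. AE x in lebesgue. norm (cis (\<eta> \<bullet> x)) \<le> C"
        by (intro exI[of _ 1]) simp
    qed
    ultimately obtain c where "AE x in lebesgue. cis (\<eta> \<bullet> x) = c"
      using const by blast
    then show "\<eta> \<in> {0}" by (simp add: character_not_AE_const)
  qed
next
  assume "{\<eta>. m \<eta> = 0} \<subseteq> {0}"
  then show "\<forall>f. Linfty f \<and> solves_mD m f \<longrightarrow> (\<exists>c. AE x in lebesgue. f x = c)"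
    using solves_mD_imp_AE_const[OF assms(2)] by blast
qed

end
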